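(* The following two formulas define Poisson brackets on $C^\infty(\mathfrak M,\mathbb R)$: for $F,H\in C^\infty(\mathfrak M,\mathbb R)$, with all derivatives evaluated at $(g,J)$, $$\{F,H\}_1(g,J)=\langle \nabla_1F,d_2H\rangle-\langle\nabla_1H,d_2F\rangle+\langle J,[d_2F,d_2H]\rangle,$$ $$\{F,H\}_2(g,J)=\langle r\nabla_1F,\nabla_1H\rangle-\langle r\nabla_1'F,\nabla_1'H\rangle+\langle \nabla_2F-\nabla_2'F,\ r_+\nabla_2'H-r_-\nabla_2H\rangle+\langle\nabla_1F,\ r_+\nabla_2'H-r_-\nabla_2H\rangle-\langle\nabla_1H,\ r_+\nabla_2'F-r_-\nabla_2F\rangle.$$
   Context: $G=\mathrm{GL}(n,\mathbb C)$ is regarded as a real Lie group with Lie algebra $\mathcal G=\mathfrak{gl}(n,\mathbb C)$ regarded as a real Lie algebra, equipped with the bilinear form $\langle X,Y\rangle=\Re\operatorname{tr}(XY)$. Every $X\in\mathcal G$ decomposes uniquely as $X=X_>+X_0+X_<$ (strictly upper triangular, diagonal, strictly lower triangular parts). Set $r(X)=\frac12(X_>-X_<)$, $r_\pm=r\pm\frac12\mathrm{id}$, and write $rX$ for $r(X)$. Let $\mathfrak M=G\times\mathcal G=\{(g,J)\}$. For $F\in C^\infty(\mathfrak M,\mathbb R)$ define $\mathcal G$-valued derivatives by $\langle\nabla_1F(g,J),X\rangle=\frac{d}{dt}\big|_{t=0}F(e^{tX}g,J)$, $\langle\nabla_1'F(g,J),X\rangle=\frac{d}{dt}\big|_{t=0}F(ge^{tX},J)$,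 $\langle d_2F(g,J),X\rangle=\frac{d}{dt}\big|_{t=0}F(g,J+tX)$ for all $X\in\mathcal G$ ($t$ real), and $\nabla_2F(g,J)=J\,d_2F(g,J)$, $\nabla_2'F(g,J)=d_2F(g,J)\,J$. *)

theory Defs
  imports "HOL-Analysis.Analysis"
begin

text \<open>Complex n x n matrices, regarded as a real vector space. The index type 'n is a
finite linear order (any such is isomorphic to {1..n}); the order defines the
strictly upper/lower triangular parts.\<close>

type_synonym 'n cmat = "complex ^'n ^'n"

definition mtrace :: "'n::finite cmat \<Rightarrow> complex" where
  "mtrace X = (\<Sum>i\<in>UNIV. X $ i $ i)"

definition pinner :: "'n::finite cmat \<Rightarrow> 'n cmat \<Rightarrow> real" where
  "pinner X Y = Re (mtrace (X ** Y))"

definition mbracket :: "'n::finite cmat \<Rightarrow> 'n cmat \<Rightarrow> 'n cmat" where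
  "mbracket X Y = X ** Y - Y ** X"

definition upper_part :: "'n::{finite,linorder} cmat \<Rightarrow> 'n cmat" where
  "upper_part X = (\<chi> i j. if i < j then X $ i $ j else 0)"

definition lower_part :: "'n::{finite,linorder} cmat \<Rightarrow> 'n cmat" where
  "lower_part X = (\<chi> i j. if j < i then X $ i $ j else 0)"

definition rmat :: "'n::{finite,linorder} cmat \<Rightarrow> 'n cmat" where
  "rmat X = (1/2) *\<^sub>R (upper_part X - lower_part X)"

definition rplus :: "'n::{finite,linorder} cmat \<Rightarrow> 'n cmat" where
  "rplus X = rmat X + (1/2) *\<^sub>R X"

definition rminus :: "'n::{finite,linorder} cmat \<Rightarrow> 'n cmat" where
  "rminus X = rmat X - (1/2) *\<^sub>R X"

fun mpow :: "'n::finite cmat \<Rightarrow> nat \<Rightarrow> 'n cmat" where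
  "mpow X 0 = mat 1"
| "mpow X (Suc k) = X ** mpow X k"

definition mexp :: "'n::finite cmat \<Rightarrow> 'n cmat" where
  "mexp X = (\<Sum>k. (1 / fact k) *\<^sub>R mpow X k)"

definition phase_space :: "('n::finite cmat \<times> 'n cmat) set" where
  "phase_space = {(g, J). invertible g}"

text \<open>Smoothness (C-infinity) of a real function on an open subset U of a real normed
space: there is a family of iterated directional derivatives D vs (D [] = f on U)
such that each D vs is Frechet differentiable at every point of U with derivative
v \<mapsto> D (v # vs).\<close>
definition smooth_on :: "'a::real_normed_vector set \<Rightarrow> ('a \<Rightarrow> real) \<Rightarrow> bool" where
  "smooth_on U f \<longleftrightarrow> (\<exists>D :: 'a list \<Rightarrow> 'a \<Rightarrow> real.
      (\<forall>x\<in>U. D [] x = f x) \<and>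
      (\<forall>vs. \<forall>x\<in>U. (D vs has_derivative (\<lambda>v. D (v # vs) x)) (at x)))"

definition nabla1 :: "('n::finite cmat \<times> 'n cmat \<Rightarrow> real) \<Rightarrow> 'n cmat \<Rightarrow> 'n cmat \<Rightarrow> 'n cmat" where
  "nabla1 F g J = (THE Y. \<forall>X. ((\<lambda>t. F (mexp (t *\<^sub>R X) ** g, J))
       has_real_derivative pinner Y X) (at 0))"

definition nabla1' :: "('n::finite cmat \<times> 'n cmat \<Rightarrow> real) \<Rightarrow> 'n cmat \<Rightarrow> 'n cmat \<Rightarrow> 'n cmat" where
  "nabla1' F g J = (THE Y. \<forall>X. ((\<lambda>t. F (g ** mexp (t *\<^sub>R X), J))
       has_real_derivative pinner Y X) (at 0))"

definition d2 :: "('n::finite cmat \<times> 'n cmat \<Rightarrow> real) \<Rightarrow> 'n cmat \<Rightarrow> 'n cmat \<Rightarrow> 'n cmat" where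
  "d2 F g J = (THE Y. \<forall>X. ((\<lambda>t. F (g, J + t *\<^sub>R X))
       has_real_derivative pinner Y X) (at 0))"

definition nabla2 :: "('n::finite cmat \<times> 'n cmat \<Rightarrow> real) \<Rightarrow> 'n cmat \<Rightarrow> 'n cmat \<Rightarrow> 'n cmat" where
  "nabla2 F g J = J ** d2 F g J"

definition nabla2' :: "('n::finite cmat \<times> 'n cmat \<Rightarrow> real) \<Rightarrow> 'n cmat \<Rightarrow> 'n cmat \<Rightarrow> 'n cmat" where
  "nabla2' F g J = d2 F g J ** J"

definition pb1 :: "('n::finite cmat \<times> 'n cmat \<Rightarrow> real) \<Rightarrow> ('n cmat \<times> 'n cmat \<Rightarrow> real)
    \<Rightarrow> 'n cmat \<times> 'n cmat \<Rightarrow> real" where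
  "pb1 F H = (\<lambda>(g, J).
     pinner (nabla1 F g J) (d2 H g J) - pinner (nabla1 H g J) (d2 F g J)
     + pinner J (mbracket (d2 F g J) (d2 H g J)))"

definition pb2 :: "('n::{finite,linorder} cmat \<times> 'n cmat \<Rightarrow> real) \<Rightarrow> ('n cmat \<times> 'n cmat \<Rightarrow> real)
    \<Rightarrow> 'n cmat \<times> 'n cmat \<Rightarrow> real" where
  "pb2 F H = (\<lambda>(g, J).
     pinner (rmat (nabla1 F g J)) (nabla1 H g J)
     - pinner (rmat (nabla1' F g J)) (nabla1' H g J)
     + pinner (nabla2 F g J - nabla2' F g J) (rplus (nabla2' H g J) - rminus (nabla2 H g J))
     + pinner (nabla1 F g J) (rplus (nabla2' H g J) - rminus (nabla2 H g J))
     - pinner (nabla1 H g J) (rplus (nabla2' F g J) - rminus (nabla2 F g J)))"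

definition is_poisson_bracket ::
  "'a::real_normed_vector set \<Rightarrow> (('a \<Rightarrow> real) \<Rightarrow> ('a \<Rightarrow> real) \<Rightarrow> 'a \<Rightarrow> real) \<Rightarrow> bool" where
  "is_poisson_bracket U B \<longleftrightarrow>
    (\<forall>F H. smooth_on U F \<longrightarrow> smooth_on U H \<longrightarrow> smooth_on U (B F H)) \<and>
    (\<forall>F H. smooth_on U F \<longrightarrow> smooth_on U H \<longrightarrow> (\<forall>p\<in>U. B F H p = - B H F p)) \<and>
    (\<forall>F H K a b. smooth_on U F \<longrightarrow> smooth_on U H \<longrightarrow> smooth_on U K \<longrightarrow>
        (\<forall>p\<in>U. B F (\<lambda>q. a * H q + b * K q) p = a * B F H p + b * B F K p)) \<and>
    (\<forall>F H K. smooth_on U F \<longrightarrow> smooth_on U H \<longrightarrow> smooth_on U K \<longrightarrow>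
        (\<forall>p\<in>U. B F (\<lambda>q. H q * K q) p = B F H p * K p + H p * B F K p)) \<and>
    (\<forall>F H K. smooth_on U F \<longrightarrow> smooth_on U H \<longrightarrow> smooth_on U K \<longrightarrow>
        (\<forall>p\<in>U. B F (B H K) p + B H (B K F) p + B K (B F H) p = 0))"

end

theory Submission
  imports Defs
begin

text \<open>
  Let \<open>(a1, a2)\<close> be the gradient of \<open>F\<close> on \<open>gl(n) \<times> gl(n)\<close> with respect to the trace form. Then
  \<open>\<nabla>\<^sub>1F = g a1\<close>, \<open>\<nabla>\<^sub>1'F = a1 g\<close> and \<open>d\<^sub>2F = a2\<close>, so both brackets are given by bivectors that are
  polynomial in \<open>(g, J)\<close>. Since Hessians are symmetric, the second derivatives cancel in the Jacobi
  identity, and it remains to show that the cyclic sum of \<open>d\<pi>(\<pi>\<^sup>#a)(b, c)\<close> vanishes for constant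
  covectors. For the second bracket, put \<open>X = g a1 + [J, a2]\<close>. Its bivector is the sum of
  \<open>\<langle>r X\<^sub>a, X\<^sub>b\<rangle>\<close>, of \<open>- \<langle>r (a1 g), b1 g\<rangle>\<close>, and of a bivector invariant under the two group actions
  involved; invariance removes the mixed terms, and the modified Yang--Baxter equation turns the terms
  quadratic in \<open>r\<close> into two cubic invariants that cancel against the contribution of the invariant part.
\<close>

section \<open>Trace identities\<close>

text \<open>Rewriting \<open>pinner\<close> through this linear functional of a single product
  reduces identities between covectors to identities between traces of words.\<close>

definition retr :: "'n::finite cmat \<Rightarrow> real" where
  "retr X = Re (mtrace X)"

lemma pinner_eq_retr: "pinner X Y = retr (X ** Y)"
  by (simp add: pinner_def retr_def)

lemma matrix_mul_diff_left: "((A::'n::finite cmat) - B) ** C = A ** C - B ** C"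
  by (simp add: matrix_matrix_mult_def vec_eq_iff left_diff_distrib sum_subtractf)
lemma matrix_mul_diff_right: "(A::'n::finite cmat) ** (B - C) = A ** B - A ** C"
  by (simp add: matrix_matrix_mult_def vec_eq_iff right_diff_distrib sum_subtractf)
lemma matrix_mul_add_left: "((A::'n::finite cmat) + B) ** C = A ** C + B ** C"
  by (simp add: matrix_matrix_mult_def vec_eq_iff distrib_right sum.distrib)
lemma matrix_mul_scaleR_left: "(c *\<^sub>R (A::'n::finite cmat)) ** B = c *\<^sub>R (A ** B)"
  by (simp add: matrix_matrix_mult_def vec_eq_iff scaleR_sum_right)
lemma matrix_mul_scaleR_right: "(A::'n::finite cmat) ** (c *\<^sub>R B) = c *\<^sub>R (A ** B)"
  by (simp add: matrix_matrix_mult_def vec_eq_iff scaleR_sum_right)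
lemma matrix_mul_minus_left: "(- (A::'n::finite cmat)) ** B = - (A ** B)"
  by (simp add: matrix_matrix_mult_def vec_eq_iff sum_negf)
lemma matrix_mul_minus_right: "(A::'n::finite cmat) ** (- B) = - (A ** B)"
  by (simp add: matrix_matrix_mult_def vec_eq_iff sum_negf)

lemma retr_add: "retr (X + Y) = retr X + retr Y"
  by (simp add: retr_def mtrace_def sum.distrib)
lemma retr_diff: "retr (X - Y) = retr X - retr Y"
  by (simp add: retr_def mtrace_def sum_subtractf)
lemma retr_minus: "retr (- X) = - retr X"
  by (simp add: retr_def mtrace_def sum_negf)
lemma retr_scaleR: "retr (c *\<^sub>R X) = c * retr X"
  by (simp add: retr_def mtrace_def sum_distrib_left)
lemma retr_mul_commute: "retr (X ** Y) = retr (Y ** X)"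
  using trace_mul_sym[of X Y] by (simp add: retr_def mtrace_def trace_def)

text \<open>Normal form: linear combinations of traces of right-nested words. Cyclicity is left out
  because unrestricted rotation would loop; proofs add it for chosen letters only.\<close>

lemmas retr_expand =
  matrix_mul_diff_left matrix_mul_diff_right matrix_mul_add_left matrix_add_ldistrib
  matrix_mul_scaleR_left matrix_mul_scaleR_right matrix_mul_minus_left matrix_mul_minus_right
  matrix_mul_assoc[symmetric] retr_add retr_diff retr_minus retr_scaleR
  scaleR_add_right scaleR_diff_right

section \<open>The r-matrix and its Yang-Baxter equation\<close>

lemma rmat_nth: "rmat X $ i $ j =
    (if i < j then X $ i $ j / 2 else if j < i then - (X $ i $ j) / 2 else 0)"
  by (auto simp: rmat_def upper_part_def lower_part_def complex_eq_iff)

lemma retr_mul3: "retr (X ** (Y ** Z)) =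
    (\<Sum>i\<in>UNIV. \<Sum>j\<in>UNIV. \<Sum>k\<in>UNIV. Re (X $ i $ j * Y $ j $ k * Z $ k $ i))"
  by (simp add: retr_def mtrace_def matrix_matrix_mult_def sum_distrib_left mult.assoc)

text \<open>\<open>rmat\<close> weights the entry at \<open>(i, j)\<close> by half the sign of
  \<open>j - i\<close>, and the trace pairs it with the entry at \<open>(j, i)\<close>, whose weight
  is opposite.\<close>

lemma rmat_antisym: "retr (rmat X ** Y) = - retr (X ** rmat Y)"
proof -
  have "retr (rmat X ** Y) = (\<Sum>i\<in>UNIV. \<Sum>j\<in>UNIV. Re (rmat X $ i $ j * Y $ j $ i))"
    by (simp add: retr_def mtrace_def matrix_matrix_mult_def)
  also have "\<dots> = (\<Sum>i\<in>UNIV. \<Sum>j\<in>UNIV. - Re (X $ i $ j * rmat Y $ j $ i))"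
    by (intro sum.cong refl) (auto simp: rmat_nth)
  also have "\<dots> = - retr (X ** rmat Y)"
    by (simp add: retr_def mtrace_def matrix_matrix_mult_def flip: sum_negf)
  finally show ?thesis .
qed

text \<open>With \<open>s i j = sgn (j - i)\<close> one has \<open>s i j * s j k + s j k * s k i + s k i * s i j = -1\<close> unless
  \<open>i = j = k\<close>. The diagonal defect is symmetric in the three matrices, so it disappears upon
  antisymmetrization, which leaves the modified classical Yang--Baxter equation.\<close>

lemma rmat_symmetrized:
  "retr (rmat X ** (rmat Y ** Z)) + retr (X ** (rmat Y ** rmat Z)) + retr (rmat X ** (Y ** rmat Z))
   = (1/4) * ((\<Sum>i\<in>UNIV. Re (X $ i $ i * Y $ i $ i * Z $ i $ i)) - retr (X ** (Y ** Z)))"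
proof -
  \<comment> \<open>The diagonal sum is spread over all triples \<open>(i, j, k)\<close> so that the
    claim can be checked summand by summand.\<close>
  have diag: "(\<Sum>i\<in>UNIV. Re (X $ i $ i * Y $ i $ i * Z $ i $ i)) =
      (\<Sum>i\<in>UNIV. \<Sum>j\<in>UNIV. \<Sum>k\<in>UNIV.
        if j = i then if k = i then Re (X $ i $ j * Y $ j $ k * Z $ k $ i) else 0 else 0)"
  proof (intro sum.cong refl)
    fix i :: 'a
    have "(\<Sum>j\<in>UNIV. \<Sum>k\<in>UNIV. if j = i then if k = i then Re (X $ i $ j * Y $ j $ k * Z $ k $ i) else 0 else 0)
       = (\<Sum>j\<in>UNIV. if j = i then (\<Sum>k\<in>UNIV. if k = i then Re (X $ i $ j * Y $ j $ k * Z $ k $ i) else 0) else 0)"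
      by (intro sum.cong refl) simp
    then show "Re (X $ i $ i * Y $ i $ i * Z $ i $ i) = (\<Sum>j\<in>UNIV. \<Sum>k\<in>UNIV.
        if j = i then if k = i then Re (X $ i $ j * Y $ j $ k * Z $ k $ i) else 0 else 0)"
      by simp
  qed
  show ?thesis
    unfolding retr_mul3 diag sum.distrib[symmetric] sum_subtractf[symmetric] sum_distrib_left
    by (intro sum.cong refl) (auto simp: rmat_nth field_simps)
qed

lemma rmat_yang_baxter:
  "retr (rmat X ** (rmat Y ** Z)) + retr (rmat Y ** (rmat Z ** X)) + retr (rmat Z ** (rmat X ** Y))
   - retr (rmat Y ** (rmat X ** Z)) - retr (rmat X ** (rmat Z ** Y)) - retr (rmat Z ** (rmat Y ** X))
   = (1/4) * (retr (Y ** (X ** Z)) - retr (X ** (Y ** Z)))"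
proof -
  have rot: "retr (A ** (B ** C)) = retr (B ** (C ** A))" for A B C :: "'a cmat"
    using retr_mul_commute[of A "B ** C"] by (simp add: matrix_mul_assoc)
  have "(\<Sum>i\<in>UNIV. Re (X $ i $ i * Y $ i $ i * Z $ i $ i)) =
    (\<Sum>i\<in>UNIV. Re (Y $ i $ i * X $ i $ i * Z $ i $ i))"
    by (simp only: mult.commute)
  then show ?thesis
    using rmat_symmetrized[of X Y Z] rmat_symmetrized[of Y X Z]
      rot[of X "rmat Y" "rmat Z"] rot[of "rmat Z" "rmat X" Y]
      rot[of Y "rmat X" "rmat Z"] rot[of "rmat Z" "rmat Y" X]
    by argo
qed

section \<open>The linear bivector\<close>

fun bivector1 :: "'n::finite cmat \<times> 'n cmat \<Rightarrow> 'n cmat \<times> 'n cmat \<Rightarrow> 'n cmat \<times> 'n cmat \<Rightarrow> real" where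
  "bivector1 (g, J) (a1, a2) (b1, b2) =
     pinner (g ** a1) b2 - pinner (g ** b1) a2 + pinner J (mbracket a2 b2)"

fun hamiltonian1 :: "'n::finite cmat \<times> 'n cmat \<Rightarrow> 'n cmat \<times> 'n cmat \<Rightarrow> 'n cmat \<times> 'n cmat" where
  "hamiltonian1 (g, J) (a1, a2) = (- (a2 ** g), g ** a1 + mbracket J a2)"

definition pair :: "'n::finite cmat \<times> 'n cmat \<Rightarrow> 'n cmat \<times> 'n cmat \<Rightarrow> real" where
  "pair a v = pinner (fst a) (fst v) + pinner (snd a) (snd v)"

lemma pair_hamiltonian1: "pair b (hamiltonian1 x a) = bivector1 x a b"
proof -
  obtain g J a1 a2 b1 b2 where [simp]: "x = (g, J)" "a = (a1, a2)" "b = (b1, b2)"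
    by (metis surj_pair)
  \<comment> \<open>Each word contains exactly one of \<open>a1\<close>, \<open>a2\<close>. Moving
    any other leading letter to the end stops once that one leads, which fixes a representative of
    the cyclic class.\<close>
  note rot = retr_mul_commute[of g] retr_mul_commute[of J] retr_mul_commute[of b1] retr_mul_commute[of b2]
  show ?thesis
    by (simp add: pair_def pinner_eq_retr mbracket_def retr_expand rot)
qed

text \<open>\<open>bivector1\<close> is linear in its base point, so its derivative along a
  Hamiltonian vector is \<open>bivector1\<close> evaluated at that vector. The cyclic sum then
  cancels word by word up to rotation.\<close>

lemma jacobi_bivector1: "bivector1 (hamiltonian1 x a) b c + bivector1 (hamiltonian1 x b) c a + bivector1 (hamiltonian1 x c) a b = 0"
proof -
  obtain g J a1 a2 b1 b2 c1 c2 where [simp]: "x = (g, J)" "a = (a1, a2)" "b = (b1, b2)" "c = (c1, c2)"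
    by (metis surj_pair)
  note rot = retr_mul_commute[of g] retr_mul_commute[of J] retr_mul_commute[of b1]
    retr_mul_commute[of b2] retr_mul_commute[of c1] retr_mul_commute[of c2]
  show ?thesis
    by (simp add: pinner_eq_retr mbracket_def retr_expand rot)
qed

section \<open>The quadratic bivector\<close>

lemma rmat_add: "rmat (X + Y) = rmat X + rmat Y"
  by (simp add: vec_eq_iff rmat_nth complex_eq_iff add_divide_distrib)
lemma rmat_diff: "rmat (X - Y) = rmat X - rmat Y"
  by (simp add: vec_eq_iff rmat_nth complex_eq_iff diff_divide_distrib)
lemma rmat_scaleR: "rmat (c *\<^sub>R X) = c *\<^sub>R rmat X"
  by (simp add: vec_eq_iff rmat_nth complex_eq_iff)

fun bivector2 :: "'n::{finite,linorder} cmat \<times> 'n cmat \<Rightarrow> 'n cmat \<times> 'n cmat \<Rightarrow> 'n cmat \<times> 'n cmat \<Rightarrow> real" where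
  "bivector2 (g, J) (a1, a2) (b1, b2) =
     pinner (rmat (g ** a1)) (g ** b1) - pinner (rmat (a1 ** g)) (b1 ** g)
     + pinner (J ** a2 - a2 ** J) (rplus (b2 ** J) - rminus (J ** b2))
     + pinner (g ** a1) (rplus (b2 ** J) - rminus (J ** b2))
     - pinner (g ** b1) (rplus (a2 ** J) - rminus (J ** a2))"

fun moment :: "'n::finite cmat \<times> 'n cmat \<Rightarrow> 'n cmat \<times> 'n cmat \<Rightarrow> 'n cmat" where
  "moment (g, J) (a1, a2) = g ** a1 + (J ** a2 - a2 ** J)"

text \<open>These are the terms left by the summands \<open>id/2\<close> and \<open>-id/2\<close> of
  \<open>rplus\<close> and \<open>rminus\<close>. The last one comes from pairing
  \<open>J ** a2 - a2 ** J\<close> with half of \<open>J ** b2 + b2 ** J\<close>, where the words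
  \<open>J a2 J b2\<close> cancel.\<close>

fun bivector0 :: "'n::finite cmat \<times> 'n cmat \<Rightarrow> 'n cmat \<times> 'n cmat \<Rightarrow> 'n cmat \<times> 'n cmat \<Rightarrow> real" where
  "bivector0 (g, J) (a1, a2) (b1, b2) =
     (1/2) * (pinner (g ** a1) (J ** b2 + b2 ** J) - pinner (J ** a2 + a2 ** J) (g ** b1)
     + pinner (J ** J) (mbracket a2 b2))"

text \<open>The bivector \<open>bivector2\<close> is the invariant bivector \<open>bivector0\<close> twisted by \<open>r\<close> along the action
  \<open>k \<cdot> (g, J) = (k g, k J k\<^sup>-\<^sup>1)\<close>, whose moment covector is \<open>moment\<close>, and along right multiplication of \<open>g\<close>.\<close>

lemma bivector2_eq: "bivector2 x a b = bivector0 x a b + pinner (rmat (moment x a)) (moment x b)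
    - pinner (rmat (fst a ** fst x)) (fst b ** fst x)"
proof -
  obtain g J a1 a2 b1 b2 where [simp]: "x = (g, J)" "a = (a1, a2)" "b = (b1, b2)"
    by (metis surj_pair)
  \<comment> \<open>An \<open>rmat\<close> at the end of a word is transferred to the product before
    it, so that no such term occurs in two forms.\<close>
  have [simp]: "retr (A ** (B ** rmat C)) = - retr (rmat (A ** B) ** C)" for A B C :: "'a cmat"
    by (simp add: rmat_antisym matrix_mul_assoc)
  note rot = retr_mul_commute[of g] retr_mul_commute[of J] retr_mul_commute[of b1] retr_mul_commute[of b2]
    retr_mul_commute[of "rmat (g ** b1)"] retr_mul_commute[of "rmat (b1 ** g)"]
    retr_mul_commute[of "rmat (J ** b2)"] retr_mul_commute[of "rmat (b2 ** J)"]
  show ?thesis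
    by (simp add: pinner_eq_retr rplus_def rminus_def mbracket_def rmat_add rmat_diff retr_expand rot)
qed

text \<open>The terms with \<open>rmat\<close> are infinitesimal generators of the two actions: left
  multiplication of \<open>g\<close> with conjugation of \<open>J\<close>, and right multiplication
  of \<open>g\<close>. In the second component the anticommutator of \<open>J\<close> with
  \<open>moment\<close> also absorbs the term \<open>[J ** J, a2] / 2\<close> coming from
  \<open>bivector0\<close>.\<close>

fun hamiltonian2 :: "'n::{finite,linorder} cmat \<times> 'n cmat \<Rightarrow> 'n cmat \<times> 'n cmat \<Rightarrow> 'n cmat \<times> 'n cmat" where
  "hamiltonian2 (g, J) (a1, a2) =
    (rmat (moment (g, J) (a1, a2)) ** g - g ** rmat (a1 ** g) - (1/2) *\<^sub>R ((J ** a2 + a2 ** J) ** g),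
     mbracket (rmat (moment (g, J) (a1, a2))) J
      + (1/2) *\<^sub>R (moment (g, J) (a1, a2) ** J + J ** moment (g, J) (a1, a2)))"

lemma pair_hamiltonian2: "pair b (hamiltonian2 x a) = bivector2 x a b"
proof -
  obtain g J a1 a2 b1 b2 where [simp]: "x = (g, J)" "a = (a1, a2)" "b = (b1, b2)"
    by (metis surj_pair)
  define X where "X = rmat (moment (g, J) (a1, a2))"
  define Y where "Y = rmat (a1 ** g)"
  note rot = retr_mul_commute[of g] retr_mul_commute[of J] retr_mul_commute[of b1] retr_mul_commute[of b2]
  show ?thesis unfolding bivector2_eq
    by (simp add: X_def[symmetric] Y_def[symmetric] del: moment.simps)
     (simp add: pair_def pinner_eq_retr mbracket_def retr_expand rot)
qed

text \<open>Derivative of \<open>bivector2\<close> at \<open>(g, J)\<close> in the direction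
  \<open>(u, v)\<close>. Antisymmetry of \<open>rmat\<close> has been used to keep
  \<open>(u, v)\<close> out of its argument, so only the six matrices named \<open>ra\<close> to
  \<open>sc\<close> below enter the Jacobi sum through \<open>rmat\<close>.\<close>

fun bivector2' :: "'n::{finite,linorder} cmat \<times> 'n cmat \<Rightarrow> 'n cmat \<times> 'n cmat \<Rightarrow>
    'n cmat \<times> 'n cmat \<Rightarrow> 'n cmat \<times> 'n cmat \<Rightarrow> real" where
  "bivector2' (g, J) (u, v) (a1, a2) (b1, b2) =
    (1/2) * (pinner (u ** a1) (J ** b2 + b2 ** J) + pinner (g ** a1) (v ** b2 + b2 ** v)
     - pinner (v ** a2 + a2 ** v) (g ** b1) - pinner (J ** a2 + a2 ** J) (u ** b1)
     + pinner (v ** J + J ** v) (mbracket a2 b2))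
    + pinner (rmat (moment (g, J) (a1, a2))) (moment (u, v) (b1, b2))
    - pinner (rmat (moment (g, J) (b1, b2))) (moment (u, v) (a1, a2))
    - pinner (rmat (a1 ** g)) (b1 ** u) + pinner (rmat (b1 ** g)) (a1 ** u)"

lemma jacobi_bivector2: "bivector2' x (hamiltonian2 x a) b c + bivector2' x (hamiltonian2 x b) c a + bivector2' x (hamiltonian2 x c) a b = 0"
proof -
  obtain g J a1 a2 b1 b2 c1 c2 where [simp]: "x = (g, J)" "a = (a1, a2)" "b = (b1, b2)" "c = (c1, c2)"
    by (metis surj_pair)
  define ra rb rc sa sb sc where
    rs: "ra = rmat (moment (g, J) (a1, a2))" "rb = rmat (moment (g, J) (b1, b2))" "rc = rmat (moment (g, J) (c1, c2))"
     "sa = rmat (a1 ** g)" "sb = rmat (b1 ** g)" "sc = rmat (c1 ** g)"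
  \<comment> \<open>Each trace monomial contains exactly one of \<open>a1, a2, ra, sa\<close>; moving every other leading
    letter to the end yields a normal form under cyclic permutation.\<close>
  note rot = retr_mul_commute[of g] retr_mul_commute[of J] retr_mul_commute[of b1]
    retr_mul_commute[of b2] retr_mul_commute[of c1] retr_mul_commute[of c2]
    retr_mul_commute[of rb] retr_mul_commute[of rc] retr_mul_commute[of sb] retr_mul_commute[of sc]
  have yb1: "retr (ra ** (rb ** moment x c)) + retr (rb ** (rc ** moment x a)) + retr (rc ** (ra ** moment x b))
   - retr (rb ** (ra ** moment x c)) - retr (ra ** (rc ** moment x b)) - retr (rc ** (rb ** moment x a))
   = (1/4) * (retr (moment x b ** (moment x a ** moment x c)) - retr (moment x a ** (moment x b ** moment x c)))"
    unfolding rs \<open>x = _\<close> \<open>a = _\<close> \<open>b = _\<close> \<open>c = _\<close> by (rule rmat_yang_baxter)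
  have yb2: "retr (sa ** (sb ** (c1 ** g))) + retr (sb ** (sc ** (a1 ** g))) + retr (sc ** (sa ** (b1 ** g)))
   - retr (sb ** (sa ** (c1 ** g))) - retr (sa ** (sc ** (b1 ** g))) - retr (sc ** (sb ** (a1 ** g)))
   = (1/4) * (retr ((b1 ** g) ** ((a1 ** g) ** (c1 ** g))) - retr ((a1 ** g) ** ((b1 ** g) ** (c1 ** g))))"
    unfolding rs by (rule rmat_yang_baxter)
  \<comment> \<open>Terms with one \<open>rmat\<close> cancel. Those with two form the left-hand
    sides of the Yang-Baxter equations for the covectors \<open>moment x a\<close> and
    \<open>a1 ** g\<close>, with opposite signs, and the terms free of \<open>rmat\<close> are the
    matching cubic right-hand sides.\<close>
  have "bivector2' x (hamiltonian2 x a) b c + bivector2' x (hamiltonian2 x b) c a + bivector2' x (hamiltonian2 x c) a b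
   = - (retr (ra ** (rb ** moment x c)) + retr (rb ** (rc ** moment x a)) + retr (rc ** (ra ** moment x b))
   - retr (rb ** (ra ** moment x c)) - retr (ra ** (rc ** moment x b)) - retr (rc ** (rb ** moment x a))
   - (1/4) * (retr (moment x b ** (moment x a ** moment x c)) - retr (moment x a ** (moment x b ** moment x c))))
   + (retr (sa ** (sb ** (c1 ** g))) + retr (sb ** (sc ** (a1 ** g))) + retr (sc ** (sa ** (b1 ** g)))
   - retr (sb ** (sa ** (c1 ** g))) - retr (sa ** (sc ** (b1 ** g))) - retr (sc ** (sb ** (a1 ** g)))
   - (1/4) * (retr ((b1 ** g) ** ((a1 ** g) ** (c1 ** g))) - retr ((a1 ** g) ** ((b1 ** g) ** (c1 ** g)))))"
    \<comment> \<open>The first pass keeps \<open>moment\<close> folded, so that its images under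
      \<open>rmat\<close> become opaque letters before the remaining moments are expanded into
      words.\<close>
    by (simp add: rs[symmetric] del: moment.simps)
      (simp add: pinner_eq_retr mbracket_def retr_expand rot,
       simp add: algebra_simps add_divide_distrib diff_divide_distrib)
  then show ?thesis using yb1 yb2 by linarith
qed

section \<open>Smooth functions\<close>

text \<open>Iterating a choice of derivatives that stays inside \<open>S\<close> produces the whole
  family of iterated derivatives demanded by \<open>smooth_on\<close>.\<close>

lemma smooth_on_coinduct:
  assumes "f \<in> S"
    and step: "\<And>f. f \<in> S \<Longrightarrow> \<exists>f'. (\<forall>v. f' v \<in> S) \<and> (\<forall>x\<in>U. (f has_derivative (\<lambda>v. f' v x)) (at x))"
  shows "smooth_on U f"
proof -
  from step obtain der where der: "\<And>f v. f \<in> S \<Longrightarrow> der f v \<in> S"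
    "\<And>f x. f \<in> S \<Longrightarrow> x \<in> U \<Longrightarrow> (f has_derivative (\<lambda>v. der f v x)) (at x)"
    by metis
  define D where "D vs = foldr (\<lambda>v h. der h v) vs f" for vs
  have "D vs \<in> S" for vs
    by (induction vs) (auto simp: D_def assms(1) der(1))
  then have "(D vs has_derivative (\<lambda>v. D (v # vs) x)) (at x)" if "x \<in> U" for vs x
    using der(2)[OF _ that] by (simp add: D_def)
  moreover have "D [] = f" by (simp add: D_def)
  ultimately show ?thesis
    unfolding smooth_on_def by blast
qed

lemma smooth_on_cong:
  assumes "smooth_on U f" "\<And>x. x \<in> U \<Longrightarrow> f x = g x"
  shows "smooth_on U g"
proof -
  obtain D where "\<forall>x\<in>U. D [] x = f x"
    "\<forall>vs. \<forall>x\<in>U. (D vs has_derivative (\<lambda>v. D (v # vs) x)) (at x)"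
    using assms(1) unfolding smooth_on_def by blast
  with assms(2) show ?thesis
    unfolding smooth_on_def by (intro exI[of _ D]) simp
qed

lemma smooth_on_derivativeE:
  assumes "open U" "smooth_on U f"
  obtains f' where "\<And>v. smooth_on U (f' v)"
    "\<And>x. x \<in> U \<Longrightarrow> (f has_derivative (\<lambda>v. f' v x)) (at x)"
proof -
  obtain D where D: "\<forall>x\<in>U. D [] x = f x"
    "\<forall>vs. \<forall>x\<in>U. (D vs has_derivative (\<lambda>v. D (v # vs) x)) (at x)"
    using assms(2) unfolding smooth_on_def by blast
  show thesis
  proof
    show "smooth_on U (D [v])" for v
      unfolding smooth_on_def
      \<comment> \<open>Lists record the most recent direction first, so the direction
        \<open>v\<close> of the initial derivative stands last.\<close>
      by (rule exI[of _ "\<lambda>vs. D (vs @ [v])"]) (use D in auto)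
    show "(f has_derivative (\<lambda>v. D [v] x)) (at x)" if "x \<in> U" for x
    proof (rule has_derivative_transform_within_open[OF _ assms(1) that])
      show "(D [] has_derivative (\<lambda>v. D [v] x)) (at x)"
        using D(2) that by blast
      show "D [] y = f y" if "y \<in> U" for y
        using D(1) that by blast
    qed
  qed
qed

text \<open>The product rule leads from products to sums of products; closing the smooth functions
  under both operations gives a set to which coinduction applies.\<close>

inductive_set smooth_algebra :: "'a::real_normed_vector set \<Rightarrow> ('a \<Rightarrow> real) set" for U where
  smooth: "smooth_on U f \<Longrightarrow> f \<in> smooth_algebra U"
| add: "f \<in> smooth_algebra U \<Longrightarrow> g \<in> smooth_algebra U \<Longrightarrow> (\<lambda>x. f x + g x) \<in> smooth_algebra U"
| mult: "f \<in> smooth_algebra U \<Longrightarrow> g \<in> smooth_algebra U \<Longrightarrow> (\<lambda>x. f x * g x) \<in> smooth_algebra U"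

lemma smooth_algebra_smooth:
  assumes "open U" "f \<in> smooth_algebra U"
  shows "smooth_on U f"
proof (rule smooth_on_coinduct[OF assms(2)])
  fix f assume "f \<in> smooth_algebra U"
  then show "\<exists>f'. (\<forall>v. f' v \<in> smooth_algebra U) \<and> (\<forall>x\<in>U. (f has_derivative (\<lambda>v. f' v x)) (at x))"
  proof induction
    case (smooth f)
    then show ?case
      using smooth_on_derivativeE[OF assms(1)] smooth_algebra.smooth by metis
  next
    case (add f g)
    then obtain f' g' where
      "\<forall>v. f' v \<in> smooth_algebra U" "\<forall>x\<in>U. (f has_derivative (\<lambda>v. f' v x)) (at x)"
      "\<forall>v. g' v \<in> smooth_algebra U" "\<forall>x\<in>U. (g has_derivative (\<lambda>v. g' v x)) (at x)"
      by blast
    then show ?case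
      by (intro exI[of _ "\<lambda>v x. f' v x + g' v x"])
        (auto intro: smooth_algebra.add has_derivative_add)
  next
    case (mult f g)
    then obtain f' g' where
      "\<forall>v. f' v \<in> smooth_algebra U" "\<forall>x\<in>U. (f has_derivative (\<lambda>v. f' v x)) (at x)"
      "\<forall>v. g' v \<in> smooth_algebra U" "\<forall>x\<in>U. (g has_derivative (\<lambda>v. g' v x)) (at x)"
      by blast
    with mult show ?case
      by (intro exI[of _ "\<lambda>v x. f x * g' v x + f' v x * g x"])
        (auto intro!: smooth_algebra.add smooth_algebra.mult has_derivative_mult)
  qed
qed

lemma smooth_on_add:
  "open U \<Longrightarrow> smooth_on U f \<Longrightarrow> smooth_on U g \<Longrightarrow> smooth_on U (\<lambda>x. f x + g x)"
  by (rule smooth_algebra_smooth) (auto intro: smooth_algebra.intros)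

lemma smooth_on_mult:
  "open U \<Longrightarrow> smooth_on U f \<Longrightarrow> smooth_on U g \<Longrightarrow> smooth_on U (\<lambda>x. f x * g x)"
  by (rule smooth_algebra_smooth) (auto intro: smooth_algebra.intros)

lemma smooth_on_const: "smooth_on U (\<lambda>x. c)"
proof (rule smooth_on_coinduct[of _ "range (\<lambda>c x. c)"])
  fix f :: "'a \<Rightarrow> real" assume "f \<in> range (\<lambda>c x. c)"
  then show "\<exists>f'. (\<forall>v. f' v \<in> range (\<lambda>c x. c)) \<and>
      (\<forall>x\<in>U. (f has_derivative (\<lambda>v. f' v x)) (at x))"
    by (intro exI[of _ "\<lambda>v x. 0"]) auto
qed simp

lemma smooth_on_bounded_linear:
  assumes "bounded_linear f"
  shows "smooth_on U f"
proof (rule smooth_on_coinduct[of _ "insert f (range (\<lambda>c x. c))"])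
  fix h assume "h \<in> insert f (range (\<lambda>c x. c))"
  then consider "h = f" | c where "h = (\<lambda>x. c)" by auto
  then show "\<exists>f'. (\<forall>v. f' v \<in> insert f (range (\<lambda>c x. c))) \<and>
      (\<forall>x\<in>U. (h has_derivative (\<lambda>v. f' v x)) (at x))"
  proof cases
    case 1
    then show ?thesis
      using bounded_linear_imp_has_derivative[OF assms] by (intro exI[of _ "\<lambda>v x. f v"]) auto
  next
    case 2
    then show ?thesis by (intro exI[of _ "\<lambda>v x. 0"]) auto
  qed
qed simp

lemma smooth_on_sum:
  assumes "open U" "\<And>i. i \<in> I \<Longrightarrow> smooth_on U (f i)"
  shows "smooth_on U (\<lambda>x. \<Sum>i\<in>I. f i x)"
  using assms(2)
proof (induction I rule: infinite_finite_induct)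
  case (insert i I)
  then show ?case
    using smooth_on_add[OF assms(1), of "f i" "\<lambda>x. \<Sum>i\<in>I. f i x"] by simp
qed (simp_all add: smooth_on_const)

section \<open>Smooth maps into Euclidean spaces\<close>

definition smooth_map_on :: "'a::real_normed_vector set \<Rightarrow> ('a \<Rightarrow> 'b::euclidean_space) \<Rightarrow> bool" where
  "smooth_map_on U f \<longleftrightarrow> (\<forall>b\<in>Basis. smooth_on U (\<lambda>x. f x \<bullet> b))"

lemma smooth_map_on_real: "smooth_map_on U f \<longleftrightarrow> smooth_on U f"
  for f :: "'a::real_normed_vector \<Rightarrow> real"
  by (simp add: smooth_map_on_def)

lemma smooth_map_on_cong:
  fixes f g :: "'a::real_normed_vector \<Rightarrow> 'b::euclidean_space"
  assumes "smooth_map_on U f" "\<And>x. x \<in> U \<Longrightarrow> f x = g x"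
  shows "smooth_map_on U g"
  unfolding smooth_map_on_def
proof
  fix b :: 'b assume "b \<in> Basis"
  then have "smooth_on U (\<lambda>x. f x \<bullet> b)"
    using assms(1) by (simp add: smooth_map_on_def)
  then show "smooth_on U (\<lambda>x. g x \<bullet> b)"
    by (rule smooth_on_cong) (simp add: assms(2))
qed

lemma smooth_map_on_bounded_linear:
  "bounded_linear f \<Longrightarrow> smooth_map_on U f"
  unfolding smooth_map_on_def
  by (intro ballI smooth_on_bounded_linear bounded_linear_inner_left_comp)

lemma smooth_map_on_const: "smooth_map_on U (\<lambda>x. c)"
  by (simp add: smooth_map_on_def smooth_on_const)

text \<open>Expanding both arguments in the bases makes each coordinate a finite sum of products of
  smooth functions.\<close>

lemma smooth_map_on_bilinear:
  fixes f :: "'a::real_normed_vector \<Rightarrow> 'b::euclidean_space" and g :: "'a \<Rightarrow> 'c::euclidean_space"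
    and h :: "'b \<Rightarrow> 'c \<Rightarrow> 'd::euclidean_space"
  assumes "open U" "bounded_bilinear h" "smooth_map_on U f" "smooth_map_on U g"
  shows "smooth_map_on U (\<lambda>x. h (f x) (g x))"
  unfolding smooth_map_on_def
proof
  fix b :: 'd assume "b \<in> Basis"
  interpret h: bounded_bilinear h by fact
  have "h (f x) (g x) \<bullet> b =
      (\<Sum>d\<in>Basis. \<Sum>c\<in>Basis. (f x \<bullet> c) * ((g x \<bullet> d) * (h c d \<bullet> b)))" for x
  proof -
    have "h (f x) (g x) = h (\<Sum>c\<in>Basis. (f x \<bullet> c) *\<^sub>R c) (\<Sum>d\<in>Basis. (g x \<bullet> d) *\<^sub>R d)"
      by (simp add: euclidean_representation)
    then show ?thesis
      by (simp add: h.sum_left h.sum_right h.scaleR_left h.scaleR_right inner_sum_left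
          sum_distrib_left mult_ac)
  qed
  then show "smooth_on U (\<lambda>x. h (f x) (g x) \<bullet> b)"
    using assms(3,4) unfolding smooth_map_on_def
    by (simp, intro smooth_on_sum smooth_on_mult assms(1) smooth_on_const) auto
qed

text \<open>Special case of the bilinear map \<open>\<lambda>c y. c *\<^sub>R h y\<close> with
  \<open>c\<close> constantly 1.\<close>

lemma smooth_map_on_linear:
  fixes f :: "'a::real_normed_vector \<Rightarrow> 'b::euclidean_space" and h :: "'b \<Rightarrow> 'c::euclidean_space"
  assumes "open U" "bounded_linear h" "smooth_map_on U f"
  shows "smooth_map_on U (\<lambda>x. h (f x))"
  using smooth_map_on_bilinear[OF assms(1)
      bounded_bilinear.comp[OF bounded_bilinear_scaleR bounded_linear_ident assms(2)]
      smooth_map_on_const[of U 1] assms(3)]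
  by simp

lemma smooth_map_on_add:
  "open U \<Longrightarrow> smooth_map_on U f \<Longrightarrow> smooth_map_on U g \<Longrightarrow> smooth_map_on U (\<lambda>x. f x + g x)"
  unfolding smooth_map_on_def inner_add_left by (intro ballI smooth_on_add) auto

lemma smooth_map_on_diff:
  assumes "open U" "smooth_map_on U f" "smooth_map_on U g"
  shows "smooth_map_on U (\<lambda>x. f x - g x)"
  using smooth_map_on_add[OF assms(1,2)
      smooth_map_on_linear[OF assms(1) bounded_linear_minus[OF bounded_linear_ident] assms(3)]]
  by simp

text \<open>The mean value theorem, applied along \<open>v\<close> and then along \<open>w\<close>,
  expresses the second difference quotient as the mixed derivative at an interior point of a small
  parallelogram; continuity at \<open>x\<close> does the rest.\<close>

lemma second_difference_estimate:
  fixes f :: "'a::real_normed_vector \<Rightarrow> real"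
  assumes "open U" "x \<in> U" "e > 0"
    and f': "\<And>v y. y \<in> U \<Longrightarrow> (f has_derivative (\<lambda>v. f' v y)) (at y)"
    and f'': "\<And>v y. y \<in> U \<Longrightarrow> (f' v has_derivative (\<lambda>w. f'' v w y)) (at y)"
    and cont: "isCont (f'' v w) x"
  shows "\<exists>d>0. \<forall>h. 0 < h \<and> h < d \<longrightarrow>
    \<bar>(f (x + h *\<^sub>R v + h *\<^sub>R w) - f (x + h *\<^sub>R v) - f (x + h *\<^sub>R w) + f x) / h\<^sup>2 - f'' v w x\<bar> < e"
proof -
  obtain r where r: "r > 0" "ball x r \<subseteq> U"
    using assms(1,2) open_contains_ball by metis
  obtain s where s: "s > 0" "\<And>y. dist y x < s \<Longrightarrow> dist (f'' v w y) (f'' v w x) < e"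
    using cont \<open>e > 0\<close> unfolding continuous_at_eps_delta by metis
  \<comment> \<open>For \<open>h < d\<close> the parallelogram spanned by \<open>h v\<close> and
    \<open>h w\<close> lies within \<open>r\<close> of \<open>x\<close>, hence in \<open>U\<close>,
    and also within \<open>s\<close>. The summand 1 avoids a zero denominator.\<close>
  define d where "d = min r s / (norm v + norm w + 1)"
  have den: "norm v + norm w + 1 > 0" by (smt (verit) norm_ge_zero)
  have "d > 0" using r(1) s(1) den by (simp add: d_def)
  have near: "dist (x + a *\<^sub>R v + b *\<^sub>R w) x < min r s"
    if "0 \<le> a" "a \<le> h" "0 \<le> b" "b \<le> h" "0 < h" "h < d" for a b h
  proof -
    have "norm (a *\<^sub>R v + b *\<^sub>R w) \<le> a * norm v + b * norm w"
      using norm_triangle_ineq[of "a *\<^sub>R v" "b *\<^sub>R w"] that by simp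
    also have "\<dots> \<le> h * norm v + h * norm w"
      using that by (intro add_mono mult_right_mono) auto
    also have "\<dots> < h * (norm v + norm w + 1)"
      using that by (simp add: algebra_simps)
    also have "\<dots> < min r s"
      using that den by (simp add: d_def pos_less_divide_eq)
    finally show ?thesis by (simp add: dist_norm add.assoc)
  qed
  have inU: "x + a *\<^sub>R v + b *\<^sub>R w \<in> U"
    if "0 \<le> a" "a \<le> h" "0 \<le> b" "b \<le> h" "0 < h" "h < d" for a b h
    using near[OF that] r(2) by (auto simp: dist_commute)
  have main: "\<bar>(f (x + h *\<^sub>R v + h *\<^sub>R w) - f (x + h *\<^sub>R v) - f (x + h *\<^sub>R w) + f x) / h\<^sup>2 - f'' v w x\<bar> < e"
    if h: "0 < h" "h < d" for h
  proof -
    \<comment> \<open>The second difference is \<open>p h - p 0\<close>.\<close>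
    define p where "p a = f (x + a *\<^sub>R v + h *\<^sub>R w) - f (x + a *\<^sub>R v + 0 *\<^sub>R w)" for a
    have dline: "((\<lambda>a. f (x + a *\<^sub>R v + b *\<^sub>R w)) has_real_derivative f' v (x + a *\<^sub>R v + b *\<^sub>R w)) (at a)"
      if "x + a *\<^sub>R v + b *\<^sub>R w \<in> U" for a b
    proof -
      have "((\<lambda>a. x + a *\<^sub>R v + b *\<^sub>R w) has_derivative (\<lambda>t. t *\<^sub>R v)) (at a)"
        by (auto intro!: derivative_eq_intros)
      from has_derivative_compose[OF this f'[OF that]]
      have "((\<lambda>a. f (x + a *\<^sub>R v + b *\<^sub>R w)) has_derivative
          (\<lambda>t. f' (t *\<^sub>R v) (x + a *\<^sub>R v + b *\<^sub>R w))) (at a)" .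
      moreover have "f' (t *\<^sub>R v) (x + a *\<^sub>R v + b *\<^sub>R w) = f' v (x + a *\<^sub>R v + b *\<^sub>R w) * t" for t
        using linear_cmul[OF has_derivative_linear[OF f'[OF that]]] by simp
      ultimately show ?thesis
        by (simp add: has_field_derivative_def)
    qed
    have dline2: "((\<lambda>b. f' v (x + a *\<^sub>R v + b *\<^sub>R w)) has_real_derivative f'' v w (x + a *\<^sub>R v + b *\<^sub>R w)) (at b)"
      if "x + a *\<^sub>R v + b *\<^sub>R w \<in> U" for a b
    proof -
      have "((\<lambda>b. x + a *\<^sub>R v + b *\<^sub>R w) has_derivative (\<lambda>t. t *\<^sub>R w)) (at b)"
        by (auto intro!: derivative_eq_intros)
      from has_derivative_compose[OF this f''[OF that]]
      have "((\<lambda>b. f' v (x + a *\<^sub>R v + b *\<^sub>R w)) has_derivative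
          (\<lambda>t. f'' v (t *\<^sub>R w) (x + a *\<^sub>R v + b *\<^sub>R w))) (at b)" .
      moreover have "f'' v (t *\<^sub>R w) (x + a *\<^sub>R v + b *\<^sub>R w) = f'' v w (x + a *\<^sub>R v + b *\<^sub>R w) * t" for t
        using linear_cmul[OF has_derivative_linear[OF f''[OF that]]] by simp
      ultimately show ?thesis
        by (simp add: has_field_derivative_def)
    qed
    have "\<exists>\<xi>. 0 < \<xi> \<and> \<xi> < h \<and> p h - p 0 =
        (h - 0) * (f' v (x + \<xi> *\<^sub>R v + h *\<^sub>R w) - f' v (x + \<xi> *\<^sub>R v + 0 *\<^sub>R w))"
    proof (rule MVT2[OF h(1)])
      fix a assume "0 \<le> a" "a \<le> h"
      then show "(p has_real_derivative
          f' v (x + a *\<^sub>R v + h *\<^sub>R w) - f' v (x + a *\<^sub>R v + 0 *\<^sub>R w)) (at a)"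
        unfolding p_def using h inU[of a h h] inU[of a h 0] by (intro DERIV_diff dline) simp_all
    qed
    then obtain \<xi> where \<xi>: "0 < \<xi>" "\<xi> < h" "p h - p 0 =
        h * (f' v (x + \<xi> *\<^sub>R v + h *\<^sub>R w) - f' v (x + \<xi> *\<^sub>R v + 0 *\<^sub>R w))"
      by auto
    have "\<exists>\<eta>. 0 < \<eta> \<and> \<eta> < h \<and> f' v (x + \<xi> *\<^sub>R v + h *\<^sub>R w) - f' v (x + \<xi> *\<^sub>R v + 0 *\<^sub>R w) =
        (h - 0) * f'' v w (x + \<xi> *\<^sub>R v + \<eta> *\<^sub>R w)"
    proof (rule MVT2[OF h(1)])
      fix b assume "0 \<le> b" "b \<le> h"
      then show "((\<lambda>b. f' v (x + \<xi> *\<^sub>R v + b *\<^sub>R w)) has_real_derivative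
          f'' v w (x + \<xi> *\<^sub>R v + b *\<^sub>R w)) (at b)"
        using h \<xi> by (intro dline2 inU[of \<xi> h b]) simp_all
    qed
    then obtain \<eta> where \<eta>: "0 < \<eta>" "\<eta> < h"
      "p h - p 0 = h * (h * f'' v w (x + \<xi> *\<^sub>R v + \<eta> *\<^sub>R w))"
      using \<xi>(3) by auto
    have "f (x + h *\<^sub>R v + h *\<^sub>R w) - f (x + h *\<^sub>R v) - f (x + h *\<^sub>R w) + f x = p h - p 0"
      by (simp add: p_def)
    then have "(f (x + h *\<^sub>R v + h *\<^sub>R w) - f (x + h *\<^sub>R v) - f (x + h *\<^sub>R w) + f x) / h\<^sup>2
        = f'' v w (x + \<xi> *\<^sub>R v + \<eta> *\<^sub>R w)"
      using \<eta>(3) h by (simp add: power2_eq_square)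
    moreover have "dist (x + \<xi> *\<^sub>R v + \<eta> *\<^sub>R w) x < s"
      using near[of \<xi> h \<eta>] \<xi> \<eta> h by simp
    ultimately show ?thesis
      using s(2) by (simp add: dist_real_def)
  qed
  then show ?thesis using \<open>d > 0\<close> by blast
qed

text \<open>The second difference quotient is symmetric in \<open>v\<close> and \<open>w\<close> and
  approximates both mixed derivatives; being within half their distance of each is
  contradictory.\<close>

lemma symmetric_second_derivative:
  fixes f :: "'a::real_normed_vector \<Rightarrow> real"
  assumes "open U" "x \<in> U"
    and f': "\<And>v y. y \<in> U \<Longrightarrow> (f has_derivative (\<lambda>v. f' v y)) (at y)"
    and f'': "\<And>v y. y \<in> U \<Longrightarrow> (f' v has_derivative (\<lambda>w. f'' v w y)) (at y)"
    and cont: "\<And>v w. isCont (f'' v w) x"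
  shows "f'' v w x = f'' w v x"
proof (rule ccontr)
  assume neq: "f'' v w x \<noteq> f'' w v x"
  define e where "e = \<bar>f'' v w x - f'' w v x\<bar> / 2"
  have "e > 0" using neq by (simp add: e_def)
  define q where "q v w h = (f (x + h *\<^sub>R v + h *\<^sub>R w) - f (x + h *\<^sub>R v) - f (x + h *\<^sub>R w) + f x) / h\<^sup>2" for v w h
  obtain d1 where d1: "d1 > 0" "\<And>h. 0 < h \<Longrightarrow> h < d1 \<Longrightarrow> \<bar>q v w h - f'' v w x\<bar> < e"
    using second_difference_estimate[OF assms(1,2) \<open>e > 0\<close> f' f'' cont[of v w]]
    by (auto simp: q_def)
  obtain d2 where d2: "d2 > 0" "\<And>h. 0 < h \<Longrightarrow> h < d2 \<Longrightarrow> \<bar>q w v h - f'' w v x\<bar> < e"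
    using second_difference_estimate[OF assms(1,2) \<open>e > 0\<close> f' f'' cont[of w v]]
    by (auto simp: q_def)
  define h where "h = min d1 d2 / 2"
  have "0 < h" "h < d1" "h < d2" using d1(1) d2(1) by (auto simp: h_def)
  then have "\<bar>q v w h - f'' v w x\<bar> < e" "\<bar>q w v h - f'' w v x\<bar> < e"
    using d1(2) d2(2) by auto
  moreover have "q v w h = q w v h" by (simp add: q_def algebra_simps)
  ultimately have "\<bar>f'' v w x - f'' w v x\<bar> < e + e" by linarith
  then show False by (simp add: e_def)
qed

section \<open>Poisson brackets from bivectors\<close>

text \<open>\<open>P'\<close> is the derivative of the bivector \<open>P\<close> in its base point, and \<open>ham x a\<close> is the Hamiltonian
  vector of the covector \<open>a\<close>; covectors are represented by vectors through the pairing \<open>pr\<close>.\<close>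

locale poisson_tensor = pr: bounded_bilinear pr
  for pr :: "'a::euclidean_space \<Rightarrow> 'a \<Rightarrow> real" +
  fixes U :: "'a set" and dual :: "'a \<Rightarrow> 'a"
    and P :: "'a \<Rightarrow> 'a \<Rightarrow> 'a \<Rightarrow> real" and P' :: "'a \<Rightarrow> 'a \<Rightarrow> 'a \<Rightarrow> 'a \<Rightarrow> real"
    and ham :: "'a \<Rightarrow> 'a \<Rightarrow> 'a"
  assumes open_domain: "open U"
    and dual: "bounded_linear dual" "\<And>a v. pr (dual a) v = a \<bullet> v"
    and pr_unique: "\<And>a b. (\<And>v. pr a v = pr b v) \<Longrightarrow> a = b"
    and pr_ham: "\<And>x a b. pr b (ham x a) = P x a b"
    and P_antisym: "\<And>x a b. P x a b = - P x b a"
    and P_has_derivative: "\<And>x \<alpha> \<alpha>' \<beta> \<beta>'. (\<alpha> has_derivative \<alpha>') (at x) \<Longrightarrow> (\<beta> has_derivative \<beta>') (at x) \<Longrightarrow>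
      ((\<lambda>y. P y (\<alpha> y) (\<beta> y)) has_derivative
        (\<lambda>v. P' x v (\<alpha> x) (\<beta> x) + P x (\<alpha>' v) (\<beta> x) + P x (\<alpha> x) (\<beta>' v))) (at x)"
    and P_smooth: "\<And>\<alpha> \<beta>. smooth_map_on U \<alpha> \<Longrightarrow> smooth_map_on U \<beta> \<Longrightarrow> smooth_on U (\<lambda>y. P y (\<alpha> y) (\<beta> y))"
    and P_jacobi: "\<And>x a b c. P' x (ham x a) b c + P' x (ham x b) c a + P' x (ham x c) a b = 0"
begin

text \<open>The sum is the gradient for the Euclidean inner product; \<open>dual\<close> converts it
  into the representative for \<open>pr\<close>.\<close>

definition grad :: "('a \<Rightarrow> real) \<Rightarrow> 'a \<Rightarrow> 'a" where
  "grad F x = dual (\<Sum>b\<in>Basis. frechet_derivative F (at x) b *\<^sub>R b)"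

lemma pr_grad:
  assumes "(F has_derivative F') (at x)"
  shows "pr (grad F x) v = F' v"
proof -
  have F': "frechet_derivative F (at x) = F'"
    using frechet_derivative_at[OF assms] by simp
  have "F' v = F' (\<Sum>b\<in>Basis. (v \<bullet> b) *\<^sub>R b)"
    by (simp add: euclidean_representation)
  also have "\<dots> = (\<Sum>b\<in>Basis. (v \<bullet> b) * F' b)"
    using has_derivative_linear[OF assms] by (simp add: linear_sum linear_cmul)
  finally show ?thesis
    by (simp add: grad_def dual(2) F' inner_sum_left inner_commute[of v] mult.commute)
qed

lemma grad_eqI:
  assumes "(F has_derivative F') (at x)" "\<And>v. pr a v = F' v"
  shows "grad F x = a"
  by (rule pr_unique) (simp add: pr_grad[OF assms(1)] assms(2))

text \<open>Lets \<open>B H K\<close>, known only on \<open>U\<close>, be replaced by its bivector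
  formula before differentiating.\<close>

lemma grad_cong:
  assumes "x \<in> U" "\<And>y. y \<in> U \<Longrightarrow> F y = H y" "(F has_derivative F') (at x)"
  shows "grad H x = grad F x"
proof (rule grad_eqI)
  show "(H has_derivative F') (at x)"
    using has_derivative_transform_within_open[OF assms(3) open_domain assms(1) assms(2)] .
qed (rule pr_grad[OF assms(3)])

lemma grad_has_derivative:
  assumes "smooth_on U F" "x \<in> U"
  shows "(F has_derivative pr (grad F x)) (at x)"
proof -
  obtain F' where "(F has_derivative F') (at x)"
    using smooth_on_derivativeE[OF open_domain assms(1)] assms(2) by metis
  moreover from this have "pr (grad F x) = F'"
    using pr_grad by blast
  ultimately show ?thesis by simp
qed

lemma smooth_grad:
  assumes "smooth_on U F"
  shows "smooth_map_on U (grad F)"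
proof -
  obtain F' where F': "\<And>v. smooth_on U (F' v)" "\<And>x. x \<in> U \<Longrightarrow> (F has_derivative (\<lambda>v. F' v x)) (at x)"
    using smooth_on_derivativeE[OF open_domain assms] by metis
  have "smooth_map_on U (\<lambda>x. \<Sum>b\<in>Basis. F' b x *\<^sub>R b :: 'a)"
    unfolding smooth_map_on_def inner_sum_left inner_scaleR_left
    by (intro ballI smooth_on_sum smooth_on_mult smooth_on_const F'(1) open_domain)
  from smooth_map_on_linear[OF open_domain dual(1) this] show ?thesis
  proof (rule smooth_map_on_cong)
    fix x assume "x \<in> U"
    from F'(2)[OF this] show "dual (\<Sum>b\<in>Basis. F' b x *\<^sub>R b) = grad F x"
      by (simp add: grad_def frechet_derivative_at[OF F'(2)[OF \<open>x \<in> U\<close>], symmetric])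
  qed
qed

lemma smooth_map_has_derivative:
  fixes f :: "'a \<Rightarrow> 'b::euclidean_space"
  assumes "smooth_map_on U f" "x \<in> U"
  shows "\<exists>f'. (f has_derivative f') (at x)"
proof -
  have "\<exists>f'. ((\<lambda>x. f x \<bullet> b) has_derivative f') (at x)" if "b \<in> Basis" for b
    using assms that smooth_on_derivativeE[OF open_domain, of "\<lambda>x. f x \<bullet> b"]
    unfolding smooth_map_on_def by metis
  then have "(\<lambda>x. f x \<bullet> b) differentiable (at x)" if "b \<in> Basis" for b
    using that by (auto simp: differentiable_def)
  then show ?thesis
    using differentiable_componentwise_within[of f x UNIV] by (auto simp: differentiable_def)
qed

text \<open>\<open>H\<close> is the Hessian read through \<open>pr\<close>. Differentiating
  \<open>pr (grad F y) w\<close>, the derivative of \<open>F\<close> along \<open>w\<close>, reduces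
  its symmetry to that of second derivatives.\<close>

lemma hessianE:
  assumes "smooth_on U F" "x \<in> U"
  obtains H where "(grad F has_derivative H) (at x)" "\<And>v w. pr (H v) w = pr (H w) v"
proof -
  obtain H where H: "(grad F has_derivative H) (at x)"
    using smooth_map_has_derivative[OF smooth_grad[OF assms(1)] assms(2)] by blast
  obtain F' where F': "\<And>v. smooth_on U (F' v)" "\<And>x. x \<in> U \<Longrightarrow> (F has_derivative (\<lambda>v. F' v x)) (at x)"
    using smooth_on_derivativeE[OF open_domain assms(1)] by metis
  have "\<exists>F''. (\<forall>w. smooth_on U (F'' w)) \<and> (\<forall>x\<in>U. (F' v has_derivative (\<lambda>w. F'' w x)) (at x))" for v
    using smooth_on_derivativeE[OF open_domain F'(1)[of v]] by metis
  then obtain F'' where F'': "\<And>v w. smooth_on U (F'' v w)"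
    "\<And>v x. x \<in> U \<Longrightarrow> (F' v has_derivative (\<lambda>w. F'' v w x)) (at x)"
    by metis
  have "isCont (F'' v w) x" for v w
    using grad_has_derivative[OF F''(1) assms(2)] has_derivative_continuous by blast
  then have sym: "F'' v w x = F'' w v x" for v w
    by (intro symmetric_second_derivative[OF open_domain assms(2), of F F' F''] F'(2) F''(2))
  have pr_H: "pr (H v) w = F'' w v x" for v w
  proof -
    have "((\<lambda>y. pr (grad F y) w) has_derivative (\<lambda>v. pr (H v) w)) (at x)"
      by (rule bounded_linear.has_derivative[OF pr.bounded_linear_left H])
    then have "(F' w has_derivative (\<lambda>v. pr (H v) w)) (at x)"
      by (rule has_derivative_transform_within_open[OF _ open_domain assms(2)])
        (simp add: pr_grad[OF F'(2)])
    from has_derivative_unique[OF this F''(2)[OF assms(2), of w]] show ?thesis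
      by metis
  qed
  show thesis by (rule that[OF H]) (simp add: pr_H sym)
qed

lemma P_add_right: "P x a (b + c) = P x a b + P x a c"
  by (simp add: pr_ham[symmetric] pr.add_left)

lemma P_scaleR_right: "P x a (t *\<^sub>R b) = t * P x a b"
  by (simp add: pr_ham[symmetric] pr.scaleR_left)

theorem poisson_bracket:
  assumes B: "\<And>F H x. smooth_on U F \<Longrightarrow> smooth_on U H \<Longrightarrow> x \<in> U \<Longrightarrow> B F H x = P x (grad F x) (grad H x)"
  shows "is_poisson_bracket U B"
proof -
  have smooth: "smooth_on U (B F H)" if "smooth_on U F" "smooth_on U H" for F H
    using P_smooth[OF smooth_grad smooth_grad, OF that] B[OF that]
    by (auto intro: smooth_on_cong)
  have lin: "B F (\<lambda>q. a * H q + b * K q) p = a * B F H p + b * B F K p"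
    if s: "smooth_on U F" "smooth_on U H" "smooth_on U K" and p: "p \<in> U" for F H K a b p
  proof -
    have sm: "smooth_on U (\<lambda>q. a * H q + b * K q)"
      by (intro smooth_on_add smooth_on_mult smooth_on_const s open_domain)
    have "((\<lambda>q. a * H q + b * K q) has_derivative
        (\<lambda>v. a * pr (grad H p) v + b * pr (grad K p) v)) (at p)"
      by (intro has_derivative_add has_derivative_mult_right grad_has_derivative s p)
    then have "grad (\<lambda>q. a * H q + b * K q) p = a *\<^sub>R grad H p + b *\<^sub>R grad K p"
      by (rule grad_eqI) (simp add: pr.add_left pr.scaleR_left)
    then show ?thesis
      by (simp add: B s sm p P_add_right P_scaleR_right)
  qed
  have leibniz: "B F (\<lambda>q. H q * K q) p = B F H p * K p + H p * B F K p"
    if s: "smooth_on U F" "smooth_on U H" "smooth_on U K" and p: "p \<in> U" for F H K p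
  proof -
    have sm: "smooth_on U (\<lambda>q. H q * K q)"
      by (intro smooth_on_mult s open_domain)
    have "((\<lambda>q. H q * K q) has_derivative
        (\<lambda>v. H p * pr (grad K p) v + pr (grad H p) v * K p)) (at p)"
      by (intro has_derivative_mult grad_has_derivative s p)
    then have "grad (\<lambda>q. H q * K q) p = H p *\<^sub>R grad K p + K p *\<^sub>R grad H p"
      by (rule grad_eqI) (simp add: pr.add_left pr.scaleR_left)
    then show ?thesis
      by (simp add: B s sm p P_add_right P_scaleR_right)
  qed
  have jacobi: "B F (B H K) p + B H (B K F) p + B K (B F H) p = 0"
    if s: "smooth_on U F" "smooth_on U H" "smooth_on U K" and p: "p \<in> U" for F H K p
  proof -
    obtain F2 where F2: "(grad F has_derivative F2) (at p)" "\<And>v w. pr (F2 v) w = pr (F2 w) v"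
      using hessianE[OF s(1) p] by blast
    obtain H2 where H2: "(grad H has_derivative H2) (at p)" "\<And>v w. pr (H2 v) w = pr (H2 w) v"
      using hessianE[OF s(2) p] by blast
    obtain K2 where K2: "(grad K has_derivative K2) (at p)" "\<And>v w. pr (K2 v) w = pr (K2 w) v"
      using hessianE[OF s(3) p] by blast
    \<comment> \<open>\<open>B F (B H K)\<close> is the derivative of \<open>B H K\<close> along the
      Hamiltonian vector of \<open>F\<close>: one term from the base point and one Hessian term for
      each of \<open>H\<close> and \<open>K\<close>.\<close>
    have nested: "B F (B H K) p = P' p (ham p (grad F p)) (grad H p) (grad K p)
        - pr (H2 (ham p (grad F p))) (ham p (grad K p)) + pr (K2 (ham p (grad F p))) (ham p (grad H p))"
      if s: "smooth_on U F" "smooth_on U H" "smooth_on U K"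
        and H2: "(grad H has_derivative H2) (at p)" and K2: "(grad K has_derivative K2) (at p)"
      for F H K H2 K2
    proof -
      note D = P_has_derivative[OF H2 K2]
      have "grad (B H K) p = grad (\<lambda>y. P y (grad H y) (grad K y)) p"
        using grad_cong[OF p _ D, of "B H K"] B[OF s(2,3)] by metis
      then have "B F (B H K) p = pr (grad (\<lambda>y. P y (grad H y) (grad K y)) p) (ham p (grad F p))"
        by (simp add: B s smooth p pr_ham)
      also have "\<dots> = P' p (ham p (grad F p)) (grad H p) (grad K p)
          + P p (H2 (ham p (grad F p))) (grad K p) + P p (grad H p) (K2 (ham p (grad F p)))"
        by (rule pr_grad[OF D])
      also have "P p (H2 (ham p (grad F p))) (grad K p) = - pr (H2 (ham p (grad F p))) (ham p (grad K p))"
        using P_antisym[of p "H2 (ham p (grad F p))" "grad K p"] by (simp add: pr_ham)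
      finally show ?thesis by (simp add: pr_ham)
    qed
    \<comment> \<open>The six Hessian terms cancel in pairs by symmetry, leaving the sum in
      \<open>P_jacobi\<close>.\<close>
    show ?thesis
      using nested[OF s(1,2,3) H2(1) K2(1)] nested[OF s(2,3,1) K2(1) F2(1)]
        nested[OF s(3,1,2) F2(1) H2(1)] P_jacobi[of p "grad F p" "grad H p" "grad K p"]
        F2(2)[of "ham p (grad H p)" "ham p (grad K p)"] H2(2)[of "ham p (grad F p)" "ham p (grad K p)"]
        K2(2)[of "ham p (grad F p)" "ham p (grad H p)"]
      by linarith
  qed
  have anti: "B F H p = - B H F p" if "smooth_on U F" "smooth_on U H" "p \<in> U" for F H p
    using P_antisym[of p "grad F p" "grad H p"] by (simp add: B that)
  show ?thesis
    unfolding is_poisson_bracket_def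
    by (intro conjI allI impI ballI; rule smooth anti lin leibniz jacobi; assumption)
qed

end

section \<open>Derivatives on the phase space\<close>

text \<open>For \<open>|t| <= 1\<close> the terms from \<open>k = 2\<close> on are bounded by
  \<open>t^2 M\<close>, with \<open>M\<close> the sum of their coefficient norms, so the error of
  the difference quotient is at most \<open>|h| M\<close>.\<close>

lemma has_vector_derivative_power_series_0:
  fixes a :: "nat \<Rightarrow> 'a::banach"
  assumes "summable (\<lambda>k. norm (a k))"
  shows "((\<lambda>t. \<Sum>k. t ^ k *\<^sub>R a k) has_vector_derivative a 1) (at 0)"
proof -
  define M where "M = (\<Sum>k. norm (a (k + 2)))"
  have sum2: "summable (\<lambda>k. norm (a (k + 2)))"
    using assms summable_iff_shift[of "\<lambda>k. norm (a k)" 2] by simp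
  have bound: "norm ((\<Sum>k. t ^ k *\<^sub>R a k) - a 0 - t *\<^sub>R a 1) \<le> t\<^sup>2 * M" if "\<bar>t\<bar> \<le> 1" for t :: real
  proof -
    have le: "norm (t ^ k *\<^sub>R a j) \<le> norm (a j)" for k j
      using that by (simp add: power_abs mult_left_le_one_le power_le_one)
    have s: "summable (\<lambda>k. t ^ k *\<^sub>R a k)"
      by (rule summable_comparison_test'[OF assms]) (rule le)
    have s2: "summable (\<lambda>k. norm (t ^ k *\<^sub>R a (k + 2)))"
      by (rule summable_comparison_test'[OF sum2]) (use le in simp)
    have "(\<Sum>k. t ^ k *\<^sub>R a k) = (\<Sum>k. t ^ (k + 2) *\<^sub>R a (k + 2)) + (a 0 + t *\<^sub>R a 1)"
      using suminf_split_initial_segment[OF s, of 2] by (simp add: numeral_2_eq_2)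
    also have "(\<Sum>k. t ^ (k + 2) *\<^sub>R a (k + 2)) = (\<Sum>k. t\<^sup>2 *\<^sub>R (t ^ k *\<^sub>R a (k + 2)))"
      by (simp add: power2_eq_square mult_ac)
    also have "\<dots> = t\<^sup>2 *\<^sub>R (\<Sum>k. t ^ k *\<^sub>R a (k + 2))"
      by (rule suminf_scaleR_right[symmetric, OF summable_norm_cancel[OF s2]])
    finally have "norm ((\<Sum>k. t ^ k *\<^sub>R a k) - a 0 - t *\<^sub>R a 1) = t\<^sup>2 * norm (\<Sum>k. t ^ k *\<^sub>R a (k + 2))"
      by simp
    also have "\<dots> \<le> t\<^sup>2 * (\<Sum>k. norm (t ^ k *\<^sub>R a (k + 2)))"
      by (intro mult_left_mono summable_norm s2) auto
    also have "\<dots> \<le> t\<^sup>2 * M"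
      unfolding M_def by (intro mult_left_mono suminf_le s2 sum2 le) auto
    finally show ?thesis .
  qed
  have f0: "(\<Sum>k. 0 ^ k *\<^sub>R a k) = a 0"
    using bound[of 0] by simp
  have "((\<lambda>h. norm ((\<Sum>k. (0 + h) ^ k *\<^sub>R a k) - (\<Sum>k. 0 ^ k *\<^sub>R a k) - h *\<^sub>R a 1) / norm h) \<longlongrightarrow> 0) (at (0::real))"
  proof (rule tendsto_sandwich[where f = "\<lambda>_. 0"])
    show "((\<lambda>h. \<bar>h\<bar> * M) \<longlongrightarrow> 0) (at (0::real))"
      by (auto intro!: tendsto_eq_intros)
    have "\<forall>\<^sub>F h in at (0::real). h \<noteq> 0 \<and> \<bar>h\<bar> \<le> 1"
      unfolding eventually_at by (intro exI[of _ 1]) (simp add: dist_real_def)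
    then show "\<forall>\<^sub>F h in at (0::real). norm ((\<Sum>k. (0 + h) ^ k *\<^sub>R a k) - (\<Sum>k. 0 ^ k *\<^sub>R a k) - h *\<^sub>R a 1) / norm h \<le> \<bar>h\<bar> * M"
    proof eventually_elim
      case (elim h)
      have "h\<^sup>2 * M = (\<bar>h\<bar> * M) * \<bar>h\<bar>"
        by (metis mult.assoc mult.commute power2_abs power2_eq_square)
      with bound[of h] elim show ?case
        by (simp add: f0 pos_divide_le_eq)
    qed
  qed (auto intro!: always_eventually)
  then show ?thesis
    unfolding has_vector_derivative_def has_derivative_at
    by (simp add: bounded_linear_scaleR_left)
qed

lemma bounded_bilinear_matrix_mul: "bounded_bilinear ((**) :: 'n::finite cmat \<Rightarrow> 'n cmat \<Rightarrow> 'n cmat)"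
  unfolding bilinear_conv_bounded_bilinear[symmetric] bilinear_def
  by (auto intro!: linearI simp: matrix_mul_add_left matrix_add_ldistrib
      matrix_mul_scaleR_left matrix_mul_scaleR_right)

lemma mpow_scaleR: "mpow (t *\<^sub>R X) k = t ^ k *\<^sub>R mpow X k"
  by (induction k) (auto simp: matrix_mul_scaleR_left matrix_mul_scaleR_right)

lemma summable_norm_mexp:
  fixes X :: "'n::finite cmat"
  shows "summable (\<lambda>k. norm ((1 / fact k) *\<^sub>R mpow X k))"
proof -
  \<comment> \<open>The constant from bounded bilinearity of the product lets the exponential series
    of \<open>norm X * C\<close>, times \<open>norm (mat 1)\<close>, dominate.\<close>
  obtain C where C: "C > 0" "\<And>(A :: 'n cmat) (B :: 'n cmat). norm (A ** B) \<le> norm A * norm B * C"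
    using bounded_bilinear.pos_bounded[OF bounded_bilinear_matrix_mul] by metis
  have le: "norm (mpow X k) \<le> (norm X * C) ^ k * norm (mat 1 :: 'n cmat)" for k
  proof (induction k)
    case (Suc k)
    have "norm (mpow X (Suc k)) \<le> norm X * norm (mpow X k) * C"
      using C(2)[of X "mpow X k"] by simp
    also have "\<dots> = (norm X * C) * norm (mpow X k)" by simp
    also have "\<dots> \<le> (norm X * C) * ((norm X * C) ^ k * norm (mat 1 :: 'n cmat))"
      using C(1) Suc by (intro mult_left_mono) auto
    finally show ?case by (simp add: mult_ac)
  qed simp
  have "summable (\<lambda>k. inverse (fact k) * (norm X * C) ^ k * norm (mat 1 :: 'n cmat))"
    by (intro summable_mult2 summable_exp)
  then show ?thesis
    by (rule summable_comparison_test'[where N = 0])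
      (use le in \<open>simp add: inverse_eq_divide divide_right_mono\<close>)
qed

lemma mexp_has_vector_derivative_0: "((\<lambda>t. mexp (t *\<^sub>R X)) has_vector_derivative X) (at 0)"
  using has_vector_derivative_power_series_0[OF summable_norm_mexp[of X]]
  by (simp add: mexp_def mpow_scaleR mult.commute)

lemma mexp_0: "mexp (0 *\<^sub>R X) = mat 1"
proof -
  \<comment> \<open>\<open>0 ^ k\<close> vanishes except for \<open>0 ^ 0 = 1\<close>, so only the
    term \<open>k = 0\<close> survives.\<close>
  have "mexp (0 *\<^sub>R X) = (\<Sum>k\<in>{0}. (1 / fact k) *\<^sub>R mpow (0 *\<^sub>R X) k)"
    unfolding mexp_def mpow_scaleR by (rule suminf_finite) auto
  then show ?thesis by simp
qed

section \<open>Nondegeneracy of the trace form\<close>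

definition adj :: "'n::finite cmat \<Rightarrow> 'n cmat" where
  "adj X = (\<chi> i j. cnj (X $ j $ i))"

lemma adj_adj: "adj (adj X) = X"
  by (simp add: adj_def vec_eq_iff)

text \<open>Since \<open>Re (cnj z * w)\<close> is the Euclidean inner product of \<open>z\<close>
  and \<open>w\<close>, the conjugate transpose turns the indefinite trace form into the standard
  inner product. This yields both nondegeneracy and the map used for \<open>dual\<close>.\<close>

lemma pinner_adj: "pinner (adj A) V = A \<bullet> V"
proof -
  have "pinner (adj A) V = (\<Sum>i\<in>UNIV. \<Sum>j\<in>UNIV. (A $ j $ i) \<bullet> (V $ j $ i))"
    by (simp add: pinner_def mtrace_def matrix_matrix_mult_def adj_def inner_complex_def)
  also have "\<dots> = (\<Sum>j\<in>UNIV. \<Sum>i\<in>UNIV. (A $ j $ i) \<bullet> (V $ j $ i))"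
    by (rule sum.swap)
  finally show ?thesis by (simp add: inner_vec_def)
qed

lemma pinner_unique:
  assumes "\<And>V. pinner A V = pinner B V"
  shows "A = B"
proof -
  have "adj A \<bullet> V = adj B \<bullet> V" for V
    using assms pinner_adj adj_adj by metis
  then have "adj A = adj B"
    by (metis vector_eq_rdot)
  then show ?thesis using adj_adj by metis
qed

lemma bounded_bilinear_pinner: "bounded_bilinear (pinner :: 'n::finite cmat \<Rightarrow> 'n cmat \<Rightarrow> real)"
  unfolding bilinear_conv_bounded_bilinear[symmetric] bilinear_def
  by (auto intro!: linearI simp: pinner_eq_retr retr_expand)

lemma bounded_linear_rmat: "bounded_linear rmat"
  unfolding linear_conv_bounded_linear[symmetric]
  by (auto intro!: linearI simp: rmat_add rmat_scaleR)

lemma bounded_bilinear_pair: "bounded_bilinear (pair :: 'n::finite cmat \<times> 'n cmat \<Rightarrow> _ \<Rightarrow> real)"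
  unfolding bilinear_conv_bounded_bilinear[symmetric] bilinear_def
  by (auto intro!: linearI simp: pair_def pinner_eq_retr retr_expand algebra_simps)

definition pair_adj :: "'n::finite cmat \<times> 'n cmat \<Rightarrow> 'n cmat \<times> 'n cmat" where
  "pair_adj a = (adj (fst a), adj (snd a))"

lemma bounded_linear_pair_adj: "bounded_linear (pair_adj :: 'n::finite cmat \<times> 'n cmat \<Rightarrow> _)"
  unfolding linear_conv_bounded_linear[symmetric]
  by (auto intro!: linearI simp: pair_adj_def adj_def vec_eq_iff)

lemma pair_pair_adj: "pair (pair_adj a) v = a \<bullet> v"
  by (simp add: pair_def pair_adj_def pinner_adj inner_prod_def)

lemma pair_unique:
  assumes "\<And>v. pair a v = pair b v"
  shows "a = b"
proof -
  have "pinner (fst a) V = pinner (fst b) V" "pinner (snd a) V = pinner (snd b) V" for V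
    using assms[of "(V, 0)"] assms[of "(0, V)"]
    by (simp_all add: pair_def bounded_bilinear.zero_right[OF bounded_bilinear_pinner])
  then show ?thesis using pinner_unique by (metis prod_eqI)
qed

lemma open_phase_space: "open (phase_space :: ('n::finite cmat \<times> 'n cmat) set)"
proof -
  have "continuous_on UNIV (\<lambda>x :: 'n cmat \<times> 'n cmat. det (fst x))"
    unfolding det_def by (intro continuous_intros)
  then have "open ((\<lambda>x :: 'n cmat \<times> 'n cmat. det (fst x)) -` (- {0}))"
    by (intro open_vimage) auto
  moreover have "phase_space = (\<lambda>x :: 'n cmat \<times> 'n cmat. det (fst x)) -` (- {0})"
    by (auto simp: phase_space_def invertible_det_nz)
  ultimately show ?thesis by simp
qed

text \<open>Chain rule along the three curves, together with
  \<open>pinner a1 (X ** g) = pinner (g ** a1) X\<close> and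
  \<open>pinner a1 (g ** X) = pinner (a1 ** g) X\<close>. Nondegeneracy of \<open>pinner\<close>
  makes the definite descriptions unique.\<close>

lemma nabla_eqI:
  fixes F :: "'n::finite cmat \<times> 'n cmat \<Rightarrow> real"
  assumes "(F has_derivative pair (a1, a2)) (at (g, J))"
  shows "nabla1 F g J = g ** a1" "nabla1' F g J = a1 ** g" "d2 F g J = a2"
proof -
  note lin = bounded_bilinear.bounded_linear_left[OF bounded_bilinear_matrix_mul]
    bounded_bilinear.bounded_linear_right[OF bounded_bilinear_matrix_mul]
  have chain: "((\<lambda>t. F (c t)) has_real_derivative pair (a1, a2) c') (at 0)"
    if "(c has_vector_derivative c') (at 0)" "c 0 = (g, J)" for c c'
  proof -
    have "((\<lambda>t. F (c t)) has_derivative (\<lambda>t. pair (a1, a2) (t *\<^sub>R c'))) (at 0)"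
      using has_derivative_compose[of c "\<lambda>t. t *\<^sub>R c'" 0 UNIV F "pair (a1, a2)"] that assms
      by (simp add: has_vector_derivative_def)
    then show ?thesis
      by (simp add: has_field_derivative_def mult_commute_abs
          bounded_bilinear.scaleR_right[OF bounded_bilinear_pair])
  qed
  have the_eq: "(THE Y. \<forall>X. (f X has_real_derivative pinner Y X) (at 0)) = Y"
    if "\<And>X. (f X has_real_derivative pinner Y X) (at 0)" for f Y
  proof (rule the_equality)
    fix Z assume "\<forall>X. (f X has_real_derivative pinner Z X) (at 0)"
    then show "Z = Y" using that DERIV_unique pinner_unique by metis
  qed (use that in blast)
  show "nabla1 F g J = g ** a1"
    unfolding nabla1_def
  proof (rule the_eq)
    fix X
    have "((\<lambda>t. (mexp (t *\<^sub>R X) ** g, J)) has_vector_derivative (X ** g, 0)) (at 0)"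
      by (intro has_vector_derivative_Pair has_vector_derivative_const
          bounded_linear.has_vector_derivative[OF lin(1)] mexp_has_vector_derivative_0)
    from chain[OF this] have "((\<lambda>t. F (mexp (t *\<^sub>R X) ** g, J)) has_real_derivative pair (a1, a2) (X ** g, 0)) (at 0)"
      by (simp only: mexp_0 matrix_mul_lid)
    moreover have "pair (a1, a2) (X ** g, 0) = pinner (g ** a1) X"
      using retr_mul_commute[of g "a1 ** X"]
      by (simp add: pair_def pinner_eq_retr matrix_mul_assoc retr_def mtrace_def)
    ultimately show "((\<lambda>t. F (mexp (t *\<^sub>R X) ** g, J)) has_real_derivative pinner (g ** a1) X) (at 0)"
      by simp
  qed
  show "nabla1' F g J = a1 ** g"
    unfolding nabla1'_def
  proof (rule the_eq)
    fix X
    have "((\<lambda>t. (g ** mexp (t *\<^sub>R X), J)) has_vector_derivative (g ** X, 0)) (at 0)"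
      by (intro has_vector_derivative_Pair has_vector_derivative_const
          bounded_linear.has_vector_derivative[OF lin(2)] mexp_has_vector_derivative_0)
    from chain[OF this] have "((\<lambda>t. F (g ** mexp (t *\<^sub>R X), J)) has_real_derivative pair (a1, a2) (g ** X, 0)) (at 0)"
      by (simp only: mexp_0 matrix_mul_rid)
    moreover have "pair (a1, a2) (g ** X, 0) = pinner (a1 ** g) X"
      by (simp add: pair_def pinner_eq_retr matrix_mul_assoc retr_def mtrace_def)
    ultimately show "((\<lambda>t. F (g ** mexp (t *\<^sub>R X), J)) has_real_derivative pinner (a1 ** g) X) (at 0)"
      by simp
  qed
  show "d2 F g J = a2"
    unfolding d2_def
  proof (rule the_eq)
    fix X
    have "((\<lambda>t. (g, J + t *\<^sub>R X)) has_vector_derivative (0, X)) (at 0)"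
      by (auto intro!: derivative_eq_intros has_vector_derivative_Pair simp: has_vector_derivative_def)
    from chain[OF this] show "((\<lambda>t. F (g, J + t *\<^sub>R X)) has_real_derivative pinner a2 X) (at 0)"
      by (simp add: pair_def bounded_bilinear.zero_right[OF bounded_bilinear_pinner])
  qed
qed

section \<open>Differentiation and smoothness of the bivectors\<close>

lemma bivector1_fst_snd: "bivector1 x a b =
    pinner (fst x ** fst a) (snd b) - pinner (fst x ** fst b) (snd a)
    + pinner (snd x) (snd a ** snd b - snd b ** snd a)"
  by (cases x; cases a; cases b) (simp add: mbracket_def)

lemma moment_fst_snd: "moment x a = fst x ** fst a + (snd x ** snd a - snd a ** snd x)"
  by (cases x; cases a) simp

lemma bivector0_fst_snd: "bivector0 x a b =
    (1/2) * (pinner (fst x ** fst a) (snd x ** snd b + snd b ** snd x)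
     - pinner (snd x ** snd a + snd a ** snd x) (fst x ** fst b)
     + pinner (snd x ** snd x) (snd a ** snd b - snd b ** snd a))"
  by (cases x; cases a; cases b) (simp add: mbracket_def)

lemma bivector1_antisym: "bivector1 x a b = - bivector1 x b a"
  by (simp add: bivector1_fst_snd pinner_eq_retr retr_expand)

lemma bivector2_antisym: "bivector2 x a b = - bivector2 x b a"
proof -
  have r: "pinner (rmat X) Y = - pinner (rmat Y) X" for X Y :: "'a cmat"
    using rmat_antisym[of X Y] retr_mul_commute[of X "rmat Y"] by (simp add: pinner_eq_retr)
  have p: "pinner X Y = pinner Y X" for X Y :: "'a cmat"
    unfolding pinner_eq_retr by (rule retr_mul_commute)
  have "bivector0 x a b = - bivector0 x b a"
    using p[of "fst x ** fst a" "snd x ** snd b + snd b ** snd x"]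
      p[of "fst x ** fst b" "snd x ** snd a + snd a ** snd x"]
    by (simp add: bivector0_fst_snd pinner_eq_retr[of _ "_ - _"] matrix_mul_diff_right retr_diff field_simps)
  then show ?thesis
    using r[of "moment x a" "moment x b"] r[of "fst a ** fst x" "fst b ** fst x"]
    by (simp add: bivector2_eq)
qed

lemmas matrix_has_derivative =
  has_derivative_add has_derivative_diff has_derivative_mult_right
  has_derivative_fst has_derivative_snd has_derivative_ident
  bounded_bilinear.FDERIV[OF bounded_bilinear_pinner]
  bounded_bilinear.FDERIV[OF bounded_bilinear_matrix_mul]
  bounded_linear.has_derivative[OF bounded_linear_rmat]

lemma bivector1_has_derivative:
  assumes "(\<alpha> has_derivative \<alpha>') (at x)" "(\<beta> has_derivative \<beta>') (at x)"
  shows "((\<lambda>y. bivector1 y (\<alpha> y) (\<beta> y)) has_derivative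
    (\<lambda>v. bivector1 v (\<alpha> x) (\<beta> x) + bivector1 x (\<alpha>' v) (\<beta> x) + bivector1 x (\<alpha> x) (\<beta>' v))) (at x)"
  unfolding bivector1_fst_snd
  by (rule has_derivative_eq_rhs, (rule matrix_has_derivative assms)+)
    (simp add: fun_eq_iff pinner_eq_retr retr_expand)

lemma moment_has_derivative:
  assumes "(\<alpha> has_derivative \<alpha>') (at x)"
  shows "((\<lambda>y. moment y (\<alpha> y)) has_derivative (\<lambda>v. moment v (\<alpha> x) + moment x (\<alpha>' v))) (at x)"
  unfolding moment_fst_snd
  by (rule has_derivative_eq_rhs, (rule matrix_has_derivative assms)+) (simp add: fun_eq_iff)

lemma right_moment_has_derivative:
  fixes \<alpha> :: "'n::finite cmat \<times> 'n cmat \<Rightarrow> 'n cmat \<times> 'n cmat"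
  assumes "(\<alpha> has_derivative \<alpha>') (at x)"
  shows "((\<lambda>y. fst (\<alpha> y) ** fst y) has_derivative
    (\<lambda>v. fst (\<alpha> x) ** fst v + fst (\<alpha>' v) ** fst x)) (at x)"
  by (rule has_derivative_eq_rhs, (rule matrix_has_derivative assms)+) simp

definition bivector0' where "bivector0' x v a b =
    (1/2) * (pinner (fst v ** fst a) (snd x ** snd b + snd b ** snd x)
     + pinner (fst x ** fst a) (snd v ** snd b + snd b ** snd v)
     - pinner (snd v ** snd a + snd a ** snd v) (fst x ** fst b)
     - pinner (snd x ** snd a + snd a ** snd x) (fst v ** fst b)
     + pinner (snd v ** snd x + snd x ** snd v) (snd a ** snd b - snd b ** snd a))"

lemma bivector0_has_derivative:
  assumes "(\<alpha> has_derivative \<alpha>') (at x)" "(\<beta> has_derivative \<beta>') (at x)"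
  shows "((\<lambda>y. bivector0 y (\<alpha> y) (\<beta> y)) has_derivative
    (\<lambda>v. bivector0' x v (\<alpha> x) (\<beta> x) + bivector0 x (\<alpha>' v) (\<beta> x) + bivector0 x (\<alpha> x) (\<beta>' v))) (at x)"
  unfolding bivector0_fst_snd bivector0'_def
  by (rule has_derivative_eq_rhs, (rule matrix_has_derivative assms)+)
    (simp add: fun_eq_iff pinner_eq_retr retr_expand field_simps)

text \<open>This is the form delivered by the product rule; antisymmetry of \<open>rmat\<close>
  links it to the form used for the Jacobi identity.\<close>

lemma bivector2'_eq: "bivector2' x v a b = bivector0' x v a b
    + pinner (rmat (moment x a)) (moment v b) + pinner (rmat (moment v a)) (moment x b)
    - pinner (rmat (fst a ** fst x)) (fst b ** fst v) - pinner (rmat (fst a ** fst v)) (fst b ** fst x)"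
proof -
  have r: "pinner (rmat X) Y = - pinner (rmat Y) X" for X Y :: "'a cmat"
    using rmat_antisym[of X Y] retr_mul_commute[of X "rmat Y"] by (simp add: pinner_eq_retr)
  show ?thesis
    unfolding r[of "moment v a" "moment x b"] r[of "fst a ** fst v"]
    by (cases x; cases v; cases a; cases b) (simp add: bivector0'_def mbracket_def)
qed

lemma bivector2_has_derivative:
  assumes "(\<alpha> has_derivative \<alpha>') (at x)" "(\<beta> has_derivative \<beta>') (at x)"
  shows "((\<lambda>y. bivector2 y (\<alpha> y) (\<beta> y)) has_derivative
    (\<lambda>v. bivector2' x v (\<alpha> x) (\<beta> x) + bivector2 x (\<alpha>' v) (\<beta> x) + bivector2 x (\<alpha> x) (\<beta>' v))) (at x)"
proof -
  note D = bivector0_has_derivative[OF assms] moment_has_derivative[OF assms(1)] moment_has_derivative[OF assms(2)]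
    right_moment_has_derivative[OF assms(1)] right_moment_has_derivative[OF assms(2)]
  note add = bounded_bilinear.add_left[OF bounded_bilinear_pinner]
    bounded_bilinear.add_right[OF bounded_bilinear_pinner]
  show ?thesis
    unfolding bivector2_eq bivector2'_eq
    by (rule has_derivative_eq_rhs,
        (rule D has_derivative_add has_derivative_diff bounded_bilinear.FDERIV[OF bounded_bilinear_pinner]
          bounded_linear.has_derivative[OF bounded_linear_rmat])+)
      (simp add: fun_eq_iff rmat_add add)
qed

lemmas smooth_map_on_matrix =
  smooth_map_on_add smooth_map_on_diff smooth_map_on_const
  smooth_map_on_linear[OF _ bounded_linear_fst] smooth_map_on_linear[OF _ bounded_linear_snd]
  smooth_map_on_linear[OF _ bounded_linear_rmat]
  smooth_map_on_bilinear[OF _ bounded_bilinear_pinner]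
  smooth_map_on_bilinear[OF _ bounded_bilinear_matrix_mul]
  smooth_map_on_bilinear[OF _ bounded_bilinear_mult]
  smooth_map_on_bounded_linear[OF bounded_linear_ident]

lemma smooth_on_bivector1:
  assumes "open U" "smooth_map_on U \<alpha>" "smooth_map_on U \<beta>"
  shows "smooth_on U (\<lambda>y. bivector1 y (\<alpha> y) (\<beta> y))"
  unfolding smooth_map_on_real[symmetric] bivector1_fst_snd
  by (rule smooth_map_on_matrix assms)+

lemma smooth_on_bivector2:
  assumes "open U" "smooth_map_on U \<alpha>" "smooth_map_on U \<beta>"
  shows "smooth_on U (\<lambda>y. bivector2 y (\<alpha> y) (\<beta> y))"
  unfolding smooth_map_on_real[symmetric] bivector2_eq bivector0_fst_snd moment_fst_snd
  by (rule smooth_map_on_matrix assms)+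

section \<open>The two brackets as Poisson tensors\<close>

interpretation pb1: poisson_tensor pair "phase_space :: ('n::finite cmat \<times> 'n cmat) set"
  pair_adj bivector1 "\<lambda>x. bivector1" hamiltonian1
  by (intro poisson_tensor.intro poisson_tensor_axioms.intro; (rule bounded_bilinear_pair open_phase_space
      bounded_linear_pair_adj pair_pair_adj pair_hamiltonian1 jacobi_bivector1 bivector1_antisym
      | (rule pair_unique bivector1_has_derivative smooth_on_bivector1[OF open_phase_space]; simp)))

interpretation pb2: poisson_tensor pair "phase_space :: ('n::{finite,linorder} cmat \<times> 'n cmat) set"
  pair_adj bivector2 bivector2' hamiltonian2
  by (intro poisson_tensor.intro poisson_tensor_axioms.intro; (rule bounded_bilinear_pair open_phase_space
      bounded_linear_pair_adj pair_pair_adj pair_hamiltonian2 jacobi_bivector2 bivector2_antisym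
      | (rule pair_unique bivector2_has_derivative smooth_on_bivector2[OF open_phase_space]; simp)))

theorem theorem2p1:
  shows "is_poisson_bracket (phase_space :: ('n::{finite,linorder} cmat \<times> 'n cmat) set) pb1
       \<and> is_poisson_bracket (phase_space :: ('n::{finite,linorder} cmat \<times> 'n cmat) set) pb2"
proof
  have nabla: "nabla1 F g J = g ** fst (pb1.grad F (g, J))" "nabla1' F g J = fst (pb1.grad F (g, J)) ** g"
    "d2 F g J = snd (pb1.grad F (g, J))"
    if "smooth_on phase_space F" "(g, J) \<in> phase_space" for F :: "'n cmat \<times> 'n cmat \<Rightarrow> real" and g J
    using pb1.grad_has_derivative[OF that]
    by (intro nabla_eqI(1)[where ?a2.0 = "snd (pb1.grad F (g, J))"]
      nabla_eqI(2)[where ?a2.0 = "snd (pb1.grad F (g, J))"]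
      nabla_eqI(3)[where ?a1.0 = "fst (pb1.grad F (g, J))"]; simp)+
  show "is_poisson_bracket (phase_space :: ('n cmat \<times> 'n cmat) set) pb1"
  proof (rule pb1.poisson_bracket)
    fix F H :: "'n cmat \<times> 'n cmat \<Rightarrow> real" and x :: "'n cmat \<times> 'n cmat"
    assume "smooth_on phase_space F" "smooth_on phase_space H" "x \<in> phase_space"
    then show "pb1 F H x = bivector1 x (pb1.grad F x) (pb1.grad H x)"
      by (cases x) (simp add: pb1_def bivector1_fst_snd mbracket_def nabla)
  qed
  show "is_poisson_bracket (phase_space :: ('n cmat \<times> 'n cmat) set) pb2"
  proof (rule pb2.poisson_bracket)
    fix F H :: "'n cmat \<times> 'n cmat \<Rightarrow> real" and x :: "'n cmat \<times> 'n cmat"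
    assume asm: "smooth_on phase_space F" "smooth_on phase_space H" "x \<in> phase_space"
    obtain g J where x: "x = (g, J)" by (cases x)
    obtain a1 a2 b1 b2 where "pb1.grad F x = (a1, a2)" "pb1.grad H x = (b1, b2)"
      by (metis surj_pair)
    \<comment> \<open>\<open>pb1.grad\<close> and \<open>pb2.grad\<close> have the same definition
      through \<open>pair_adj\<close>, so the formulas \<open>nabla\<close> serve the second bracket
      as well.\<close>
    with asm show "pb2 F H x = bivector2 x (pb2.grad F x) (pb2.grad H x)"
      by (simp add: x pb2_def nabla nabla2_def nabla2'_def pb1.grad_def pb2.grad_def)
  qed
qed

end
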